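(* Let $X,Y$ be random variables with values in finite sets $\mathcal X,\mathcal Y$, let $t\ge1$, and let $U^1,\dots,U^t$ be binary random variables, jointly distributed with $(X,Y)$, such that for every $i\in\{1,\dots,t\}$ the Markov chain $U^i\to(X,U^{1:i-1})\to Y$ holds if $i$ is odd and the Markov chain $U^i\to(Y,U^{1:i-1})\to X$ holds if $i$ is even. Let $0<\beta_3<\beta<1/2$. For $N=2^n$ let $\mathbf U_A^{1:t}=(\bar U_A^1,\dots,\bar U_A^t)$ and $\mathbf U_B^{1:t}=(\bar U_B^1,\dots,\bar U_B^t)$ be the sequences formed by Terminals A and B in the $t$-round protocol described in the context (with $\delta_N=2^{-N^\beta}$), let $Q_{\mathbf U_A^{1:t}\bar X\bar Y}$ and $Q_{\mathbf U_B^{1:t}\bar X\bar Y}$ be the induced laws of $(\mathbf U_A^{1:t},\bar X,\bar Y)$ and $(\mathbf U_B^{1:t},\bar X,\bar Y)$, and let $P_{\mathbf U^{1:t}\bar X\bar Y}$ be the law of $N$ i.i.d. copies of $(U^1,\dots,U^t,X,Y)$. Then, as $N\to\infty$, $$\Pr\{\mathbf U_A^{1:t}=\mathbf U_B^{1:t}\}=1-O(2^{-N^{\beta_3}}),$$ $$\big\|Q_{\mathbf U_A^{1:t}\bar X\bar Y}-P_{\mathbf U^{1:t}\bar X\bar Y}\big\|_1=O(2^{-N^{\beta_3}}),\qquad \big\|Q_{\mathbf U_B^{1:t}\bar X\bar Y}-P_{\mathbf U^{1:t}\bar X\bar Y}\big\|_1=O(2^{-N^{\beta_3}}).$$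
   Context: Polarization notation. $N=2^n$, $n\in\mathbb N$; $[N]=\{1,\dots,N\}$; $\delta_N=2^{-N^\beta}$. A bar denotes an $N$-vector, $w^{1:k}=(w^1,\dots,w^k)$, and $U^{1:k}=(U^1,\dots,U^k)$. $G_N=B_NF^{\otimes n}$ over $\mathbb F_2$, where $F=\begin{pmatrix}1&0\\1&1\end{pmatrix}$, $\otimes$ is the Kronecker product and $B_N$ is the $N\times N$ bit-reversal permutation matrix. For a binary random variable $T$ and a discrete random variable $V$, $Z(T|V)=2\sum_{v}P_V(v)\sqrt{P_{T|V}(0|v)P_{T|V}(1|v)}$. For a binary $U$ and a discrete $W$ with a given joint law, let $(\bar U,\bar W)$ be $N$ i.i.d. copies of $(U,W)$ and $\bar V=\bar UG_N$; put $\mathcal L_U=\{i\in[N]:Z(V^i|V^{1:i-1})\le\delta_N\}$, $\mathcal L_{U|W}=\{i\in[N]:Z(V^i|V^{1:i-1},\bar W)\le\delta_N\}$, $\mathcal H_{U|W}=\{i\in[N]:Z(V^i|V^{1:i-1},\bar W)\ge1-\delta_N\}$. The superscript $c$ is complement in $[N]$. Ideal distribution. $P$ denotes the law of $(\bar X,\bar Y,\bar U^1,\dots,\bar U^t,\bar V^1,\dots,\bar V^t)$, where $(\bar X,\bar Y,\bar U^1,\dots,\bar U^t)$ are $N$ i.i.d. copies of $(X,Y,U^1,\dots,U^t)$ and $\bar V^\ell=\bar U^\ell G_N$; its marginals and conditionals are also denoted $P$ (conditional laws given zero-probability events are fixed arbitrarily). Protocol. Terminal A observes $\bar X$, Terminal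 B observes $\bar Y$, where $(\bar X,\bar Y)$ are $N$ i.i.d. copies of $(X,Y)$. In round $\ell=1,\dots,t$ the transmitter $S$ is A if $\ell$ is odd and B if $\ell$ is even; the receiver $R$ is the other terminal. Put $W_A=X$, $W_B=Y$ and $\mathcal F_r^\ell=\mathcal L_{U^\ell}^c\cap\mathcal H_{U^\ell|(W_S,U^{1:\ell-1})}$, $\mathcal F_d^\ell=\mathcal L_{U^\ell}$, $\mathcal I^\ell=\mathcal L_{U^\ell}^c\cap\mathcal H^c_{U^\ell|(W_S,U^{1:\ell-1})}$, $\mathcal I'^\ell=\mathcal I^\ell\setminus(\mathcal L^c_{U^\ell}\cap\mathcal L_{U^\ell|(W_R,U^{1:\ell-1})})$. The transmitter generates $\bar v_S^\ell$ successively for $j=1,\dots,N$: if $j\in\mathcal F_r^\ell$, $(v_S^\ell)^j$ is a uniform bit; if $j\in\mathcal F_d^\ell$, it is sampled from $P_{(V^\ell)^j|(V^\ell)^{1:j-1}}(\cdot|(v_S^\ell)^{1:j-1})$; if $j\in\mathcal I^\ell$, it is sampled from $P_{(V^\ell)^j|(V^\ell)^{1:j-1},\bar W_S,\bar U^1,\dots,\bar U^{\ell-1}}(\cdot|(v_S^\ell)^{1:j-1},\bar w_S,\bar u_S^1,\dots,\bar u_S^{\ell-1})$. It sends the bits $(v_S^\ell)^j$, $j\in\mathcal I'^\ell$. The receiver sets $(v_R^\ell)^j=(v_S^\ell)^j$ for $j\in\mathcal I'^\ell$; for $j\in\mathcal F_r^\ell$ it uses the same uniform bit as the transmitter (shared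 randomness); for $j\in\mathcal F_d^\ell$ it samples from $P_{(V^\ell)^j|(V^\ell)^{1:j-1}}(\cdot|(v_R^\ell)^{1:j-1})$; for $j\in\mathcal I^\ell\setminus\mathcal I'^\ell$ it samples from $P_{(V^\ell)^j|(V^\ell)^{1:j-1},\bar W_R,\bar U^1,\dots,\bar U^{\ell-1}}(\cdot|(v_R^\ell)^{1:j-1},\bar w_R,\bar u_R^1,\dots,\bar u_R^{\ell-1})$. The private samplings of the terminals use independent randomness, and shared bits are independent of everything else. Finally $\bar u_A^\ell=\bar v_A^\ell G_N$, $\bar u_B^\ell=\bar v_B^\ell G_N$. $\|\cdot\|_1$ is the $\ell_1$ distance between probability mass functions. The constants in $O(\cdot)$ do not depend on $N$. *)

theory Defs
  imports
    "HOL-Probability.Probability"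
    "HOL-Library.Landau_Symbols"
    "HOL-Library.Z2"
    "HOL-Library.Monad_Syntax"
    "Jordan_Normal_Form.Matrix"
begin

section \<open>Discrete random variables\<close>

text \<open>
  A random variable is a function on a discrete probability space, given by its pmf.
  For \<open>v\<close> outside the support of \<open>V\<close> the conditional law is the arbitrary \<open>d v\<close>.
\<close>

definition cond_law ::
  "('v \<Rightarrow> 'a pmf) \<Rightarrow> 'w pmf \<Rightarrow> ('w \<Rightarrow> 'a) \<Rightarrow> ('w \<Rightarrow> 'v) \<Rightarrow> 'v \<Rightarrow> 'a pmf" where
  "cond_law d P T V v =
     (if v \<in> set_pmf (map_pmf V P) then map_pmf T (cond_pmf P {\<omega>. V \<omega> = v}) else d v)"

text \<open>The Markov chain \<open>S \<rightarrow> T \<rightarrow> V\<close>.\<close>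

definition markov_chain ::
  "'w pmf \<Rightarrow> ('w \<Rightarrow> 'a) \<Rightarrow> ('w \<Rightarrow> 'b) \<Rightarrow> ('w \<Rightarrow> 'c) \<Rightarrow> bool" where
  "markov_chain P S T V \<longleftrightarrow>
     (\<forall>a b c. b \<in> set_pmf (map_pmf T P) \<longrightarrow>
        \<P>(\<omega> in measure_pmf P. S \<omega> = a \<and> V \<omega> = c \<bar> T \<omega> = b) =
        \<P>(\<omega> in measure_pmf P. S \<omega> = a \<bar> T \<omega> = b) *
        \<P>(\<omega> in measure_pmf P. V \<omega> = c \<bar> T \<omega> = b))"

definition bhattacharyya :: "'w pmf \<Rightarrow> ('w \<Rightarrow> bit) \<Rightarrow> ('w \<Rightarrow> 'v) \<Rightarrow> real" where
  "bhattacharyya P T V =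
     2 * (\<Sum>\<^sub>\<infinity>v. pmf (map_pmf V P) v *
            sqrt (\<P>(\<omega> in measure_pmf P. T \<omega> = 0 \<bar> V \<omega> = v) *
                  \<P>(\<omega> in measure_pmf P. T \<omega> = 1 \<bar> V \<omega> = v)))"

definition l1_dist :: "'a pmf \<Rightarrow> 'a pmf \<Rightarrow> real" where
  "l1_dist q p = (\<Sum>\<^sub>\<infinity>z. \<bar>pmf q z - pmf p z\<bar>)"

section \<open>The polar transform\<close>

definition kronecker :: "'a :: semiring_1 mat \<Rightarrow> 'a mat \<Rightarrow> 'a mat" where
  "kronecker A B = Matrix.mat (dim_row A * dim_row B) (dim_col A * dim_col B)
     (\<lambda>(i, j). A $$ (i div dim_row B, j div dim_col B) * B $$ (i mod dim_row B, j mod dim_col B))"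

primrec kronecker_power :: "'a :: semiring_1 mat \<Rightarrow> nat \<Rightarrow> 'a mat" where
  "kronecker_power A 0 = 1\<^sub>m 1"
| "kronecker_power A (Suc n) = kronecker A (kronecker_power A n)"

definition arikan_kernel :: "bit mat" where
  "arikan_kernel = mat_of_rows_list 2 [[1, 0], [1, 1]]"

definition bit_reversal :: "nat \<Rightarrow> nat \<Rightarrow> nat" where
  "bit_reversal n i = (\<Sum>k<n. (i div 2 ^ k mod 2) * 2 ^ (n - 1 - k))"

definition bit_reversal_mat :: "nat \<Rightarrow> bit mat" where
  "bit_reversal_mat n =
     Matrix.mat (2 ^ n) (2 ^ n) (\<lambda>(i, j). if j = bit_reversal n i then 1 else 0)"

definition polar_mat :: "nat \<Rightarrow> bit mat" where
  "polar_mat n = bit_reversal_mat n * kronecker_power arikan_kernel n"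

text \<open>The product of the row vector \<open>u\<close>, of length \<open>2 ^ n\<close>, with the polarization matrix.\<close>

definition polarize :: "nat \<Rightarrow> bit list \<Rightarrow> bit list" where
  "polarize n u = list_of_vec (Matrix.row (mat_of_row (vec_of_list u) * polar_mat n) 0)"

section \<open>Polarization sets\<close>

text \<open>
  The block length is \<open>2 ^ n\<close>, and blocks are lists of length \<open>2 ^ n\<close>. Positions are counted from
  \<open>0\<close>, so the symbols preceding position \<open>i\<close> form the prefix of length \<open>i\<close>.
\<close>

definition iid :: "nat \<Rightarrow> 'w pmf \<Rightarrow> 'w list pmf" where
  "iid n p = replicate_pmf (2 ^ n) p"

definition polar_bit :: "nat \<Rightarrow> ('w \<Rightarrow> bit) \<Rightarrow> nat \<Rightarrow> 'w list \<Rightarrow> bit" where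
  "polar_bit n T i \<omega>s = polarize n (map T \<omega>s) ! i"

definition polar_past :: "nat \<Rightarrow> ('w \<Rightarrow> bit) \<Rightarrow> nat \<Rightarrow> 'w list \<Rightarrow> bit list" where
  "polar_past n T i \<omega>s = take i (polarize n (map T \<omega>s))"

definition polar_delta :: "real \<Rightarrow> nat \<Rightarrow> real" where
  "polar_delta \<beta> n = 2 powr (- (real (2 ^ n) powr \<beta>))"

definition low_set :: "'w pmf \<Rightarrow> real \<Rightarrow> nat \<Rightarrow> ('w \<Rightarrow> bit) \<Rightarrow> nat set" where
  "low_set p \<beta> n T =
     {i \<in> {..<2 ^ n}. bhattacharyya (iid n p) (polar_bit n T i) (polar_past n T i)
        \<le> polar_delta \<beta> n}"

definition low_set_cond ::
  "'w pmf \<Rightarrow> real \<Rightarrow> nat \<Rightarrow> ('w \<Rightarrow> bit) \<Rightarrow> ('w \<Rightarrow> 'v) \<Rightarrow> nat set" where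
  "low_set_cond p \<beta> n T W =
     {i \<in> {..<2 ^ n}. bhattacharyya (iid n p) (polar_bit n T i)
        (\<lambda>\<omega>s. (polar_past n T i \<omega>s, map W \<omega>s)) \<le> polar_delta \<beta> n}"

definition high_set_cond ::
  "'w pmf \<Rightarrow> real \<Rightarrow> nat \<Rightarrow> ('w \<Rightarrow> bit) \<Rightarrow> ('w \<Rightarrow> 'v) \<Rightarrow> nat set" where
  "high_set_cond p \<beta> n T W =
     {i \<in> {..<2 ^ n}. bhattacharyya (iid n p) (polar_bit n T i)
        (\<lambda>\<omega>s. (polar_past n T i \<omega>s, map W \<omega>s)) \<ge> 1 - polar_delta \<beta> n}"

section \<open>The interactive protocol\<close>

datatype terminal = Terminal_A | Terminal_B

definition transmitter :: "nat \<Rightarrow> terminal" where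
  "transmitter l = (if odd l then Terminal_A else Terminal_B)"

definition receiver :: "nat \<Rightarrow> terminal" where
  "receiver l = (if odd l then Terminal_B else Terminal_A)"

fun observed :: "terminal \<Rightarrow> 'x \<times> 'y \<Rightarrow> 'x + 'y" where
  "observed Terminal_A (x, y) = Inl x"
| "observed Terminal_B (x, y) = Inr y"

text \<open>Bit \<open>j\<close> is sampled from \<open>K v\<close>, where \<open>v\<close> is the list of the \<open>j\<close> bits generated before it.\<close>

primrec sample_bits :: "(bit list \<Rightarrow> bit pmf) \<Rightarrow> nat \<Rightarrow> bit list pmf" where
  "sample_bits K 0 = return_pmf []"
| "sample_bits K (Suc j) =
     do {v \<leftarrow> sample_bits K j; b \<leftarrow> K v; return_pmf (v @ [b])}"

text \<open>
  The variables \<open>U l\<close> are indexed by the rounds \<open>l = 1, \<dots>, t\<close>. The functions \<open>d0\<close> and \<open>d1\<close> choose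
  the conditional laws given events of probability zero: \<open>d0 l v\<close> without side information, and
  \<open>d1 l (v, ws, us)\<close> given also the observed block \<open>ws\<close> and the blocks \<open>us\<close> of the earlier rounds.
  Here \<open>v\<close> consists of the bits before the one being sampled, so its length is the position of
  that bit.
\<close>

context
  fixes p :: "'w pmf" and X :: "'w \<Rightarrow> 'x" and Y :: "'w \<Rightarrow> 'y" and U :: "nat \<Rightarrow> 'w \<Rightarrow> bit"
    and \<beta> :: real and n :: nat
    and d0 :: "nat \<Rightarrow> bit list \<Rightarrow> bit pmf"
    and d1 :: "nat \<Rightarrow> bit list \<times> ('x + 'y) list \<times> bit list list \<Rightarrow> bit pmf"
begin

definition side_info :: "terminal \<Rightarrow> nat \<Rightarrow> 'w \<Rightarrow> ('x + 'y) \<times> bit list" where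
  "side_info s l \<omega> = (observed s (X \<omega>, Y \<omega>), map (\<lambda>i. U i \<omega>) [1..<l])"

definition set_Fr :: "nat \<Rightarrow> nat set" where
  "set_Fr l = ({..<2 ^ n} - low_set p \<beta> n (U l)) \<inter>
     high_set_cond p \<beta> n (U l) (side_info (transmitter l) l)"

definition set_Fd :: "nat \<Rightarrow> nat set" where
  "set_Fd l = low_set p \<beta> n (U l)"

definition set_I :: "nat \<Rightarrow> nat set" where
  "set_I l = ({..<2 ^ n} - low_set p \<beta> n (U l)) \<inter>
     ({..<2 ^ n} - high_set_cond p \<beta> n (U l) (side_info (transmitter l) l))"

text \<open>The positions of the transmitted bits.\<close>

definition set_I' :: "nat \<Rightarrow> nat set" where
  "set_I' l = set_I l - (({..<2 ^ n} - low_set p \<beta> n (U l)) \<inter>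
     low_set_cond p \<beta> n (U l) (side_info (receiver l) l))"

definition free_law :: "nat \<Rightarrow> bit list \<Rightarrow> bit pmf" where
  "free_law l v = cond_law (d0 l) (iid n p)
     (polar_bit n (U l) (length v)) (polar_past n (U l) (length v)) v"

definition side_law ::
  "terminal \<Rightarrow> nat \<Rightarrow> ('x + 'y) list \<Rightarrow> bit list list \<Rightarrow> bit list \<Rightarrow> bit pmf" where
  "side_law s l ws us v = cond_law (d1 l) (iid n p)
     (polar_bit n (U l) (length v))
     (\<lambda>\<omega>s. (polar_past n (U l) (length v) \<omega>s,
            map (\<lambda>\<omega>. observed s (X \<omega>, Y \<omega>)) \<omega>s,
            map (\<lambda>i. map (U i) \<omega>s) [1..<l]))
     (v, ws, us)"

text \<open>
  Round \<open>l\<close>, where \<open>w s\<close> is the block observed by terminal \<open>s\<close> and \<open>u s\<close> is the list of the blocks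
  formed by \<open>s\<close> in the earlier rounds. The family \<open>r\<close> consists of the shared uniform bits.
\<close>

definition protocol_round ::
  "(terminal \<Rightarrow> ('x + 'y) list) \<Rightarrow> nat \<Rightarrow> (terminal \<Rightarrow> bit list list) \<Rightarrow>
   (terminal \<Rightarrow> bit list list) pmf" where
  "protocol_round w l u = (let S = transmitter l; R = receiver l in do {
     r \<leftarrow> Pi_pmf (set_Fr l) 0 (\<lambda>_. pmf_of_set {0, 1});
     vS \<leftarrow> sample_bits (\<lambda>v. let j = length v in
            if j \<in> set_Fr l then return_pmf (r j)
            else if j \<in> set_Fd l then free_law l v
            else side_law S l (w S) (u S) v) (2 ^ n);
     vR \<leftarrow> sample_bits (\<lambda>v. let j = length v in
            if j \<in> set_I' l then return_pmf (vS ! j)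
            else if j \<in> set_Fr l then return_pmf (r j)
            else if j \<in> set_Fd l then free_law l v
            else side_law R l (w R) (u R) v) (2 ^ n);
     return_pmf (u(S := u S @ [polarize n vS], R := u R @ [polarize n vR]))
   })"

primrec protocol_rounds ::
  "(terminal \<Rightarrow> ('x + 'y) list) \<Rightarrow> nat \<Rightarrow> (terminal \<Rightarrow> bit list list) pmf" where
  "protocol_rounds w 0 = return_pmf (\<lambda>_. [])"
| "protocol_rounds w (Suc l) = protocol_rounds w l \<bind> protocol_round w (Suc l)"

text \<open>
  The joint law of the blocks formed by the two terminals in \<open>t\<close> rounds, the source block of
  Terminal A and the source block of Terminal B.
\<close>

definition protocol_law ::
  "nat \<Rightarrow> (bit list list \<times> bit list list \<times> 'x list \<times> 'y list) pmf" where
  "protocol_law t = do {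
     xy \<leftarrow> iid n (map_pmf (\<lambda>\<omega>. (X \<omega>, Y \<omega>)) p);
     u \<leftarrow> protocol_rounds (\<lambda>s. map (observed s) xy) t;
     return_pmf (u Terminal_A, u Terminal_B, map fst xy, map snd xy)
   }"

definition ideal_law :: "nat \<Rightarrow> (bit list list \<times> 'x list \<times> 'y list) pmf" where
  "ideal_law t =
     map_pmf (\<lambda>\<omega>s. (map (\<lambda>i. map (U i) \<omega>s) [1..<Suc t], map X \<omega>s, map Y \<omega>s)) (iid n p)"

end

end

theory Submission
  imports Defs "HOL-Real_Asymp.Real_Asymp"
begin

text \<open>
  Total variation is controlled for the joint law of the sources and of the blocks of both
  terminals, compared with the law in which both terminals hold the ideal blocks; agreement and
  both marginal estimates are then immediate. By induction it suffices to start a round from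
  ideal blocks. Merging the shared bits with the transmitter's word, both words are generated bit
  by bit, and each bit costs at most \<open>sqrt \<delta>\<close>: at a position with \<open>Z \<ge> 1 - \<delta>\<close> the ideal bit is
  almost uniform, and at a position with \<open>Z \<le> \<delta>\<close> a sample from the conditional law almost always
  equals the ideal bit. The Markov chains ensure that the transmitter's kernels remain
  the ideal ones given the sources of both terminals, and the polar transform is an involution.
  The total \<open>2 t N sqrt \<delta>\<close> beats \<open>2 powr (- (N powr \<beta>\<^sub>3))\<close> because \<open>\<beta>\<^sub>3 < \<beta>\<close>.
\<close>

section \<open>The polar transform\<close>

text \<open>A round asks different things of its two words. The sender's word need only have the
  right law, but jointly with both sources; its kernels are therefore exchanged one position at a
  time behind an ideal prefix. The receiver must hit the very same word, so its sampling is compared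
  with the ideal word outcome by outcome; this is a matter of prediction, settled by a small
  \<open>Z\<close> given its own view. On \<open>set_Fd\<close> the terminals even sample with
  separate randomness, and agree because each predicts the same ideal bit.

  The bounds on \<open>Z\<close> are averages under the ideal law and say nothing about an
  individual prefix or history. A kernel's error can thus be charged only at ideal arguments: errors
  made earlier are first paid for as a change of law, and only then are the kernels of the next bit
  or round compared.

  The square root comes from the nearly uniform positions alone: there the bias is controlled by
  \<open>sqrt (1 - Z)\<close>, while a position with small \<open>Z\<close> costs at most
  \<delta>/2.\<close>

lemma sum_lessThan_double:
  fixes f :: "nat \<Rightarrow> 'a::comm_monoid_add"
  shows "(\<Sum>m<2 * M. f m) = (\<Sum>m<M. f m) + (\<Sum>m<M. f (M + m))"
proof -
  have "{..<2 * M} = {..<M} \<union> (+) M ` {..<M}"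
  proof -
    have "x \<in> (+) M ` {..<M}" if "x < 2 * M" "\<not> x < M" for x
      using that by (intro image_eqI[of _ _ "x - M"]) auto
    then show ?thesis by auto
  qed
  moreover have "sum f ((+) M ` {..<M}) = (\<Sum>m<M. f (M + m))"
    by (subst sum.reindex) auto
  ultimately show ?thesis
    by (simp, subst sum.union_disjoint) auto
qed

section \<open>Entries of the Kronecker powers of the kernel\<close>

lemma kronecker_power_carrier:
  "A \<in> carrier_mat k k \<Longrightarrow> kronecker_power A n \<in> carrier_mat (k ^ n) (k ^ n)"
  by (induction n) (auto simp: kronecker_def)

lemma arikan_kernel_carrier: "arikan_kernel \<in> carrier_mat 2 2"
  by (intro carrier_matI) (simp_all add: arikan_kernel_def mat_of_rows_list_def)

lemma arikan_kernel_index: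
  assumes "a < 2" "b < 2"
  shows "arikan_kernel $$ (a, b) = of_bool (b \<le> a)"
  using assms by (auto simp: arikan_kernel_def mat_of_rows_list_def less_2_cases_iff)

abbreviation arikan_power :: "nat \<Rightarrow> bit mat" where
  "arikan_power n \<equiv> kronecker_power arikan_kernel n"

lemma arikan_power_carrier: "arikan_power n \<in> carrier_mat (2 ^ n) (2 ^ n)"
  by (rule kronecker_power_carrier[OF arikan_kernel_carrier])

lemma arikan_power_dim: "dim_row (arikan_power n) = 2 ^ n" "dim_col (arikan_power n) = 2 ^ n"
  using arikan_power_carrier by auto

lemma arikan_power_Suc_index:
  assumes "i < 2 ^ Suc n" "j < 2 ^ Suc n"
  shows "arikan_power (Suc n) $$ (i, j) =
    of_bool (j div 2 ^ n \<le> i div 2 ^ n) * arikan_power n $$ (i mod 2 ^ n, j mod 2 ^ n)"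
proof -
  have "i div 2 ^ n < 2" "j div 2 ^ n < 2"
    using assms by (auto simp: less_mult_imp_div_less)
  then show ?thesis
    using assms arikan_kernel_carrier
    by (simp add: kronecker_def arikan_power_dim arikan_kernel_index)
qed

text \<open>Each Kronecker factor contributes one binary digit, and the kernel has a one at
  \<open>(a, b)\<close> exactly when \<open>b \<le> a\<close>. The power is thus the inclusion
  matrix of digit sets, a form in which bit reversal is easy to follow.\<close>

lemma arikan_power_index:
  assumes "i < 2 ^ n" "j < 2 ^ n"
  shows "arikan_power n $$ (i, j) = of_bool (\<forall>k<n. bit j k \<longrightarrow> bit i k)"
  using assms
proof (induction n arbitrary: i j)
  case 0
  then show ?case by simp
next
  case (Suc n)
  have d: "m div 2 ^ n = of_bool (bit m n)" if "m < 2 ^ Suc n" for m :: nat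
  proof -
    have "m div 2 ^ n < 2"
      using that by (auto simp: less_mult_imp_div_less)
    then show ?thesis
      by (auto simp: bit_iff_odd less_2_cases_iff)
  qed
  have "arikan_power (Suc n) $$ (i, j) =
    of_bool (j div 2 ^ n \<le> i div 2 ^ n) * arikan_power n $$ (i mod 2 ^ n, j mod 2 ^ n)"
    by (rule arikan_power_Suc_index[OF Suc.prems])
  also have "\<dots> = of_bool (bit j n \<longrightarrow> bit i n) * of_bool (\<forall>k<n. bit j k \<longrightarrow> bit i k)"
    unfolding d[OF Suc.prems(1)] d[OF Suc.prems(2)]
    by (subst Suc.IH) (auto simp: take_bit_eq_mod[symmetric] bit_take_bit_iff)
  also have "\<dots> = of_bool (\<forall>k<Suc n. bit j k \<longrightarrow> bit i k)"
    by (auto simp: less_Suc_eq)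
  finally show ?case .
qed

text \<open>The kernel squares to the identity in characteristic two, hence so do its Kronecker
  powers. The sum over \<open>m\<close> is split by the leading digit of \<open>m\<close>.\<close>

lemma arikan_power_square_index:
  assumes "i < 2 ^ n" "j < 2 ^ n"
  shows "(\<Sum>m<2 ^ n. arikan_power n $$ (i, m) * arikan_power n $$ (m, j)) = of_bool (i = j)"
  using assms
proof (induction n arbitrary: i j)
  case 0
  then show ?case by simp
next
  case (Suc n)
  let ?N = "2 ^ n :: nat" and ?K = "arikan_power n"
  define a b where "a = i div ?N" and "b = j div ?N"
  have ab: "a < 2" "b < 2"
    using Suc.prems by (auto simp: a_def b_def less_mult_imp_div_less)
  have entry: "arikan_power (Suc n) $$ (i, c * ?N + m) * arikan_power (Suc n) $$ (c * ?N + m, j)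
      = of_bool (b \<le> c \<and> c \<le> a) * (?K $$ (i mod ?N, m) * ?K $$ (m, j mod ?N))"
    if "c < 2" "m < ?N" for c m
  proof -
    have "c * ?N + m < 2 ^ Suc n"
      using that by (auto simp: less_2_cases_iff)
    with that show ?thesis
      using Suc.prems by (simp add: arikan_power_Suc_index del: power_Suc kronecker_power.simps)
        (auto simp: a_def b_def)
  qed
  have "(\<Sum>m<2 ^ Suc n. arikan_power (Suc n) $$ (i, m) * arikan_power (Suc n) $$ (m, j)) =
    (\<Sum>m<?N. of_bool (b \<le> 0) * (?K $$ (i mod ?N, m) * ?K $$ (m, j mod ?N))) +
    (\<Sum>m<?N. of_bool (b \<le> 1 \<and> 1 \<le> a) * (?K $$ (i mod ?N, m) * ?K $$ (m, j mod ?N)))"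
    using entry[of 0] entry[of 1]
    by (simp add: sum_lessThan_double del: kronecker_power.simps cong: sum.cong_simp)
  also have "\<dots> = (of_bool (b \<le> 0) + of_bool (b \<le> 1 \<and> 1 \<le> a)) *
      (\<Sum>m<?N. ?K $$ (i mod ?N, m) * ?K $$ (m, j mod ?N))"
    by (simp only: sum_distrib_left[symmetric] distrib_right)
  also have "\<dots> = (of_bool (b \<le> 0) + of_bool (b \<le> 1 \<and> 1 \<le> a)) * of_bool (i mod ?N = j mod ?N)"
    by (subst Suc.IH) auto
  \<comment> \<open>If \<open>a = 1\<close> and \<open>b = 0\<close>, both halves contribute and
    \<open>1 + 1 = 0\<close> in \<open>bit\<close>; if \<open>a = 0\<close> and
    \<open>b = 1\<close>, neither does.\<close>
  also have "\<dots> = of_bool (a = b \<and> i mod ?N = j mod ?N)"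
    using ab by (auto simp: less_2_cases_iff)
  also have "a = b \<and> i mod ?N = j mod ?N \<longleftrightarrow> i = j"
    unfolding a_def b_def by (metis div_mult_mod_eq)
  finally show ?case .
qed

section \<open>Bit reversal on binary digits\<close>

lemma bit_reversal_eq: "bit_reversal n i = (\<Sum>k<n. of_bool (bit i (n - 1 - k)) * 2 ^ k)"
proof -
  have "bit_reversal n i = (\<Sum>k<n. of_bool (bit i k) * 2 ^ (n - 1 - k))"
    unfolding bit_reversal_def by (auto intro!: sum.cong simp: bit_iff_odd mod_2_eq_odd)
  also have "\<dots> = (\<Sum>k<n. of_bool (bit i (n - 1 - k)) * 2 ^ k)"
    by (rule sum.reindex_bij_witness[of _ "\<lambda>k. n - 1 - k" "\<lambda>k. n - 1 - k"]) auto
  finally show ?thesis .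
qed

lemma bit_reversal_horner:
  "bit_reversal n i = horner_sum of_bool 2 (map (\<lambda>k. bit i (n - 1 - k)) [0..<n])"
  by (simp add: bit_reversal_eq horner_sum_eq_sum lessThan_atLeast0)

lemma bit_bit_reversal: "bit (bit_reversal n i) k \<longleftrightarrow> k < n \<and> bit i (n - 1 - k)"
  by (auto simp: bit_reversal_horner bit_horner_sum_bit_iff)

lemma bit_reversal_less: "bit_reversal n i < 2 ^ n"
proof -
  have "take_bit n (bit_reversal n i) = bit_reversal n i"
    by (rule bit_eqI) (auto simp: bit_take_bit_iff bit_bit_reversal)
  then show ?thesis
    by (metis take_bit_nat_less_exp)
qed

lemma bit_reversal_involution:
  assumes "i < 2 ^ n"
  shows "bit_reversal n (bit_reversal n i) = i"
proof (rule bit_eqI)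
  fix k
  have "bit i k \<Longrightarrow> k < n"
    using assms by (metis bit_take_bit_iff take_bit_nat_eq_self)
  then show "bit (bit_reversal n (bit_reversal n i)) k = bit i k"
    by (auto simp: bit_bit_reversal)
qed

text \<open>Inclusion of digit sets survives a common permutation of the digits. In matrix terms,
  bit reversal commutes with the kernel power.\<close>

lemma arikan_power_bit_reversal:
  assumes "i < 2 ^ n" "j < 2 ^ n"
  shows "arikan_power n $$ (bit_reversal n i, bit_reversal n j) = arikan_power n $$ (i, j)"
proof -
  have "(\<forall>k<n. bit j (n - 1 - k) \<longrightarrow> bit i (n - 1 - k)) \<longleftrightarrow> (\<forall>k<n. bit j k \<longrightarrow> bit i k)"
    (is "?l \<longleftrightarrow> ?r")
  proof
    assume l: ?l
    show ?r
    proof (intro allI impI)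
      fix k assume "k < n" "bit j k"
      with l[rule_format, of "n - 1 - k"] show "bit i k" by auto
    qed
  qed auto
  with assms show ?thesis
    by (auto simp: arikan_power_index bit_reversal_less bit_bit_reversal)
qed

section \<open>The polarization matrix is its own inverse\<close>

lemma polar_mat_carrier: "polar_mat n \<in> carrier_mat (2 ^ n) (2 ^ n)"
  unfolding polar_mat_def bit_reversal_mat_def
  by (intro mult_carrier_mat[OF _ arikan_power_carrier]) auto

lemma polar_mat_index:
  assumes "i < 2 ^ n" "j < 2 ^ n"
  shows "polar_mat n $$ (i, j) = arikan_power n $$ (bit_reversal n i, j)"
proof -
  have "polar_mat n $$ (i, j) =
     (\<Sum>k = 0..<2 ^ n. (if k = bit_reversal n i then 1 else 0) * arikan_power n $$ (k, j))"
    using assms by (simp add: polar_mat_def bit_reversal_mat_def scalar_prod_def arikan_power_dim)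
  also have "\<dots> = (\<Sum>k = 0..<2 ^ n. if k = bit_reversal n i then arikan_power n $$ (k, j) else 0)"
    by (intro sum.cong) auto
  also have "\<dots> = arikan_power n $$ (bit_reversal n i, j)"
    by (simp add: bit_reversal_less)
  finally show ?thesis .
qed

text \<open>The two factors commute and both are involutions. In indices, substituting
  \<open>bit_reversal n m\<close> for \<open>m\<close> moves the reversal to where
  \<open>arikan_power_bit_reversal\<close> removes it.\<close>

lemma polar_mat_square: "polar_mat n * polar_mat n = 1\<^sub>m (2 ^ n)"
proof (rule eq_matI)
  fix i j assume ij: "i < dim_row (1\<^sub>m (2 ^ n) :: bit mat)" "j < dim_col (1\<^sub>m (2 ^ n) :: bit mat)"
  then have "(polar_mat n * polar_mat n) $$ (i, j) =
      (\<Sum>m<2 ^ n. polar_mat n $$ (i, m) * polar_mat n $$ (m, j))"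
    using polar_mat_carrier[of n] by (simp add: scalar_prod_def lessThan_atLeast0)
  also have "\<dots> = (\<Sum>m<2 ^ n. arikan_power n $$ (bit_reversal n i, m) *
      arikan_power n $$ (bit_reversal n m, j))"
    using ij by (intro sum.cong) (auto simp: polar_mat_index)
  also have "\<dots> = (\<Sum>m<2 ^ n. arikan_power n $$ (bit_reversal n i, bit_reversal n m) *
      arikan_power n $$ (m, j))"
    by (rule sum.reindex_bij_witness[of _ "bit_reversal n" "bit_reversal n"])
      (auto simp: bit_reversal_involution bit_reversal_less)
  also have "\<dots> = (\<Sum>m<2 ^ n. arikan_power n $$ (i, m) * arikan_power n $$ (m, j))"
    using ij by (intro sum.cong) (auto simp: arikan_power_bit_reversal)
  also have "\<dots> = 1\<^sub>m (2 ^ n) $$ (i, j)"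
    using ij by (subst arikan_power_square_index) auto
  finally show "(polar_mat n * polar_mat n) $$ (i, j) = 1\<^sub>m (2 ^ n) $$ (i, j)" .
qed (use polar_mat_carrier[of n] in auto)

lemma length_polarize [simp]: "length (polarize n u) = 2 ^ n"
  using polar_mat_carrier[of n] by (simp add: polarize_def)

lemma polarize_involution:
  assumes "length u = 2 ^ n"
  shows "polarize n (polarize n u) = u"
proof -
  let ?u = "mat_of_row (vec_of_list u)"
  have c: "?u \<in> carrier_mat 1 (2 ^ n)"
    using assms by (intro carrier_matI) auto
  have "mat_of_row (Matrix.row (?u * polar_mat n) 0) = ?u * polar_mat n"
    using c polar_mat_carrier[of n] by (intro eq_matI) auto
  then have "polarize n (polarize n u) = list_of_vec (Matrix.row (?u * polar_mat n * polar_mat n) 0)"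
    by (simp add: polarize_def vec_list)
  also have "?u * polar_mat n * polar_mat n = ?u"
    by (subst assoc_mult_mat[OF c polar_mat_carrier polar_mat_carrier])
      (simp add: polar_mat_square right_mult_one_mat[OF c])
  finally show ?thesis
    by (simp add: list_vec)
qed

section \<open>Conditional laws and the Bhattacharyya parameter\<close>

lemma integrable_pmf_bounded:
  fixes f :: "'a \<Rightarrow> real"
  assumes "\<And>x. \<bar>f x\<bar> \<le> B"
  shows "integrable (measure_pmf M) f"
  by (rule measure_pmf.integrable_const_bound[of _ B]) (use assms in auto)

lemma expectation_bind_pmf:
  fixes f :: "'a \<Rightarrow> real"
  assumes "\<And>x. \<bar>f x\<bar> \<le> B"
  shows "measure_pmf.expectation (bind_pmf M K) f =
    measure_pmf.expectation M (\<lambda>x. measure_pmf.expectation (K x) f)"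
  unfolding measure_pmf_bind
proof (rule integral_bind[where K = "count_space UNIV" and B = B and B' = 1])
  show "(\<lambda>x. measure_pmf (K x)) \<in> measurable (measure_pmf M) (subprob_algebra (count_space UNIV))"
    using measurable_measure_pmf[of K] by simp
  show "finite_measure (measure_pmf M)"
    by (rule measure_pmf.finite_measure_axioms)
qed (use assms in \<open>auto simp: measure_pmf.emeasure_eq_measure\<close>)

lemma expectation_pmf_bounds:
  fixes f :: "'a \<Rightarrow> real"
  assumes "\<And>x. 0 \<le> f x \<and> f x \<le> 1"
  shows "0 \<le> measure_pmf.expectation M f \<and> measure_pmf.expectation M f \<le> 1"
proof -
  have "measure_pmf.expectation M f \<le> measure_pmf.expectation M (\<lambda>_. 1)"
    by (intro integral_mono integrable_pmf_bounded[of _ 1]) (use assms in auto)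
  with assms show ?thesis
    by (simp add: integral_nonneg_AE)
qed

lemma expectation_pmf_mono:
  fixes f g :: "'a \<Rightarrow> real"
  assumes "\<And>x. x \<in> set_pmf M \<Longrightarrow> f x \<le> g x" "\<And>x. \<bar>f x\<bar> \<le> B" "\<And>x. \<bar>g x\<bar> \<le> C"
  shows "measure_pmf.expectation M f \<le> measure_pmf.expectation M g"
  by (intro integral_mono_AE integrable_pmf_bounded[OF assms(2)] integrable_pmf_bounded[OF assms(3)])
    (use assms(1) in \<open>auto simp: AE_measure_pmf_iff\<close>)

text \<open>The bridge from expectations, in which all estimates are made, to the infinite sums
  defining \<open>bhattacharyya\<close> and \<open>l1_dist\<close>.\<close>

lemma has_sum_expectation_pmf:
  fixes f :: "'a \<Rightarrow> real"
  assumes "\<And>x. \<bar>f x\<bar> \<le> B"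
  shows "((\<lambda>x. pmf p x * f x) has_sum measure_pmf.expectation p f) UNIV"
proof -
  have "integrable (density (count_space UNIV) (pmf p)) f"
    using integrable_pmf_bounded[OF assms, where M = p] by (simp add: measure_pmf_eq_density)
  then have i: "integrable (count_space UNIV) (\<lambda>x. pmf p x * f x)"
    by (subst (asm) integrable_density) auto
  then have s: "Infinite_Set_Sum.abs_summable_on (\<lambda>x. pmf p x * f x) UNIV"
    by (simp add: Infinite_Set_Sum.abs_summable_on_def)
  have "measure_pmf.expectation p f = integral\<^sup>L (density (count_space UNIV) (pmf p)) f"
    by (simp add: measure_pmf_eq_density)
  also have "\<dots> = infsetsum (\<lambda>x. pmf p x * f x) UNIV"
    by (subst integral_density) (auto simp: infsetsum_def)
  also have "\<dots> = infsum (\<lambda>x. pmf p x * f x) UNIV"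
    by (rule infsetsum_infsum[OF s])
  finally show ?thesis
    using s by (simp add: abs_summable_equivalent[symmetric] abs_summable_summable)
qed

text \<open>A joint law of the form \<open>M \<bind> (\<lambda>c. map_pmf (Pair c) (K c))\<close>
  says that \<open>K\<close> is a conditional law given the first component. Disintegrations below
  are stated in this form, which avoids division.\<close>

lemma pmf_bind_Pair:
  "pmf (M \<bind> (\<lambda>c. map_pmf (Pair c) (K c))) (c, x) = pmf M c * pmf (K c) x"
proof -
  have "pmf (map_pmf (Pair c') (K c')) (c, x) = indicator {c} c' * pmf (K c) x" for c'
  proof (cases "c' = c")
    case True
    then show ?thesis
      using pmf_map_inj'[of "Pair c" "K c" x] by (simp add: inj_on_def)
  next
    case False
    then show ?thesis
      by (auto simp: pmf_eq_0_set_pmf)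
  qed
  then show ?thesis
    by (simp add: pmf_bind measure_pmf_single)
qed

lemma bind_Pair_unique:
  assumes "M \<bind> (\<lambda>c. map_pmf (Pair c) (K c)) = M \<bind> (\<lambda>c. map_pmf (Pair c) (L c))"
    and "c \<in> set_pmf M"
  shows "K c = L c"
proof (rule pmf_eqI)
  fix x
  have "pmf M c * pmf (K c) x = pmf M c * pmf (L c) x"
    using arg_cong[OF assms(1), of "\<lambda>N. pmf N (c, x)"] by (simp only: pmf_bind_Pair)
  with assms(2) show "pmf (K c) x = pmf (L c) x"
    by (simp add: set_pmf_iff)
qed

text \<open>The bind only reaches values \<open>v\<close> in the support of \<open>V\<close>, where
  \<open>cond_law\<close> is a genuine conditional law; so the equation holds for every default
  \<open>d\<close>.\<close>

lemma disintegrate_cond_law: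
  "map_pmf (\<lambda>\<omega>. (V \<omega>, T \<omega>)) P = map_pmf V P \<bind> (\<lambda>v. map_pmf (Pair v) (cond_law d P T V v))"
proof -
  let ?C = "\<lambda>v. cond_pmf P {\<omega>. V \<omega> = v}"
  have ne: "set_pmf P \<inter> {\<omega>. V \<omega> = v} \<noteq> {}" if "v \<in> set_pmf (map_pmf V P)" for v
    using that by auto
  have P: "map_pmf V P \<bind> ?C = P"
    by (rule bind_cond_pmf_cancel[where R = "\<lambda>v \<omega>. V \<omega> = v"])
      (auto intro!: arg_cong[where f = "measure (measure_pmf P)"])
  have "map_pmf (\<lambda>\<omega>. (V \<omega>, T \<omega>)) P =
      map_pmf V P \<bind> (\<lambda>v. map_pmf (\<lambda>\<omega>. (V \<omega>, T \<omega>)) (?C v))"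
    by (subst P[symmetric]) (rule map_bind_pmf)
  also have "\<dots> = map_pmf V P \<bind> (\<lambda>v. map_pmf (Pair v) (cond_law d P T V v))"
  proof (rule bind_pmf_cong[OF refl])
    fix v assume v: "v \<in> set_pmf (map_pmf V P)"
    have "map_pmf (\<lambda>\<omega>. (V \<omega>, T \<omega>)) (?C v) = map_pmf (\<lambda>\<omega>. (v, T \<omega>)) (?C v)"
      by (rule map_pmf_cong) (auto simp: set_cond_pmf[OF ne[OF v]])
    with v show "map_pmf (\<lambda>\<omega>. (V \<omega>, T \<omega>)) (?C v) = map_pmf (Pair v) (cond_law d P T V v)"
      by (simp add: cond_law_def pmf.map_comp o_def)
  qed
  finally show ?thesis .
qed

lemma cond_prob_eq_pmf_cond_law:
  assumes "v \<in> set_pmf (map_pmf V P)"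
  shows "\<P>(\<omega> in measure_pmf P. T \<omega> = t \<bar> V \<omega> = v) = pmf (cond_law d P T V v) t"
proof -
  have "measure P {\<omega>. T \<omega> = t \<and> V \<omega> = v} = pmf (map_pmf (\<lambda>\<omega>. (V \<omega>, T \<omega>)) P) (v, t)"
    by (auto simp: pmf_map intro!: arg_cong[where f = "measure (measure_pmf P)"])
  also have "\<dots> = pmf (map_pmf V P) v * pmf (cond_law d P T V v) t"
    by (simp only: disintegrate_cond_law[of V T P d] pmf_bind_Pair)
  finally have "measure P {\<omega>. T \<omega> = t \<and> V \<omega> = v} = pmf (map_pmf V P) v * pmf (cond_law d P T V v) t" .
  moreover have "measure P {\<omega>. V \<omega> = v} = pmf (map_pmf V P) v"
    by (auto simp: pmf_map intro!: arg_cong[where f = "measure (measure_pmf P)"])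
  moreover have "pmf (map_pmf V P) v \<noteq> 0"
    using assms unfolding set_pmf_iff .
  ultimately show ?thesis
    by (simp add: cond_prob_def)
qed

lemma expectation_cond_law:
  fixes h :: "'v \<Rightarrow> 'a \<Rightarrow> real"
  assumes "\<And>v t. \<bar>h v t\<bar> \<le> B"
  shows "measure_pmf.expectation P (\<lambda>\<omega>. h (V \<omega>) (T \<omega>)) =
    measure_pmf.expectation P (\<lambda>\<omega>. measure_pmf.expectation (cond_law d P T V (V \<omega>)) (h (V \<omega>)))"
proof -
  have "measure_pmf.expectation P (\<lambda>\<omega>. h (V \<omega>) (T \<omega>)) =
      measure_pmf.expectation (map_pmf (\<lambda>\<omega>. (V \<omega>, T \<omega>)) P) (case_prod h)"
    by simp
  also have "\<dots> = measure_pmf.expectation (map_pmf V P)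
      (\<lambda>v. measure_pmf.expectation (map_pmf (Pair v) (cond_law d P T V v)) (case_prod h))"
    unfolding disintegrate_cond_law[of V T P d]
    by (rule expectation_bind_pmf[of _ B]) (use assms in auto)
  finally show ?thesis
    by simp
qed

lemma pmf_bit_0: "pmf (q :: bit pmf) 0 = 1 - pmf q 1"
proof -
  have "set_pmf q \<subseteq> insert 0 {1}"
  proof
    fix b :: bit
    show "b \<in> insert 0 {1}" by (cases b) blast+
  qed
  then have "(\<Sum>b\<in>insert 0 {1}. pmf q b) = 1"
    by (intro sum_pmf_eq_1 finite.intros)
  moreover have "(\<Sum>b\<in>insert 0 {1}. pmf q b) = pmf q 0 + pmf q 1"
    by (subst sum.insert) auto
  ultimately show ?thesis
    by linarith
qed

lemma expectation_bit:
  "measure_pmf.expectation (q :: bit pmf) f = (1 - pmf q 1) * f 0 + pmf q 1 * (f 1 :: real)"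
proof -
  have mem: "b \<in> insert 0 {1}" for b :: bit
    by (cases b) blast+
  have "measure_pmf.expectation q f = (\<Sum>b\<in>insert 0 {1}. pmf q b *\<^sub>R f b)"
    by (rule integral_measure_pmf) (intro finite.intros mem)+
  also have "\<dots> = pmf q 0 * f 0 + pmf q 1 * f 1"
    by (subst sum.insert) auto
  finally show ?thesis
    by (simp only: pmf_bit_0)
qed

text \<open>Values outside the support carry weight zero in the defining sum, so the conditional
  probabilities may be read from \<open>cond_law\<close> with any default.\<close>

lemma bhattacharyya_eq_expectation:
  "bhattacharyya P T V = 2 * measure_pmf.expectation P (\<lambda>\<omega>.
     sqrt (pmf (cond_law d P T V (V \<omega>)) 0 * pmf (cond_law d P T V (V \<omega>)) 1))"
proof -
  let ?g = "\<lambda>v. sqrt (pmf (cond_law d P T V v) 0 * pmf (cond_law d P T V v) 1)"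
  have "\<bar>?g v\<bar> \<le> 1" for v
    by (auto simp: pmf_le_1 mult_le_one)
  from infsumI[OF has_sum_expectation_pmf[of ?g 1 "map_pmf V P", OF this]]
  have "(\<Sum>\<^sub>\<infinity>v. pmf (map_pmf V P) v * ?g v) = measure_pmf.expectation P (\<lambda>\<omega>. ?g (V \<omega>))"
    by simp
  moreover have "pmf (map_pmf V P) v * sqrt (\<P>(\<omega> in measure_pmf P. T \<omega> = 0 \<bar> V \<omega> = v) *
      \<P>(\<omega> in measure_pmf P. T \<omega> = 1 \<bar> V \<omega> = v)) = pmf (map_pmf V P) v * ?g v" for v
  proof (cases "v \<in> set_pmf (map_pmf V P)")
    case True
    then show ?thesis
      by (simp only: cond_prob_eq_pmf_cond_law[where d = d])
  next
    case False
    then have "pmf (map_pmf V P) v = 0"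
      by (simp only: set_pmf_iff not_not)
    then show ?thesis
      by (simp only: mult_zero_left)
  qed
  ultimately show ?thesis
    by (simp only: bhattacharyya_def)
qed

text \<open>The parameter depends on the conditioning variable only through the partition it induces
  on the support. This allows the same side information to be stored in different layouts.\<close>

lemma bhattacharyya_cong_info:
  assumes "\<And>\<omega> \<omega>'. \<omega> \<in> set_pmf P \<Longrightarrow> \<omega>' \<in> set_pmf P \<Longrightarrow> V \<omega> = V \<omega>' \<longleftrightarrow> V' \<omega> = V' \<omega>'"
  shows "bhattacharyya P T V = bhattacharyya P T V'"
proof -
  have eq: "pmf (cond_law d P T V (V \<omega>)) t = pmf (cond_law d' P T V' (V' \<omega>)) t"
    if "\<omega> \<in> set_pmf P" for \<omega> t d d'
  proof -
    have "\<P>(\<omega>' in measure_pmf P. T \<omega>' = t \<bar> V \<omega>' = V \<omega>) =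
        \<P>(\<omega>' in measure_pmf P. T \<omega>' = t \<bar> V' \<omega>' = V' \<omega>)"
      by (rule measure_pmf.cond_prob_eq_AE)
        (use that assms in \<open>auto simp: AE_measure_pmf_iff\<close>)
    moreover have "\<P>(\<omega>' in measure_pmf P. T \<omega>' = t \<bar> V \<omega>' = V \<omega>) = pmf (cond_law d P T V (V \<omega>)) t"
      using that by (intro cond_prob_eq_pmf_cond_law) simp
    moreover have "\<P>(\<omega>' in measure_pmf P. T \<omega>' = t \<bar> V' \<omega>' = V' \<omega>) = pmf (cond_law d' P T V' (V' \<omega>)) t"
      using that by (intro cond_prob_eq_pmf_cond_law) simp
    ultimately show ?thesis
      by (simp only:)
  qed
  have "measure_pmf.expectation P (\<lambda>\<omega>. sqrt (pmf (cond_law (\<lambda>_. return_pmf 0) P T V (V \<omega>)) 0 *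
        pmf (cond_law (\<lambda>_. return_pmf 0) P T V (V \<omega>)) 1)) =
      measure_pmf.expectation P (\<lambda>\<omega>. sqrt (pmf (cond_law (\<lambda>_. return_pmf 0) P T V' (V' \<omega>)) 0 *
        pmf (cond_law (\<lambda>_. return_pmf 0) P T V' (V' \<omega>)) 1))"
  proof (rule integral_cong_AE)
    show "AE \<omega> in measure_pmf P. sqrt (pmf (cond_law (\<lambda>_. return_pmf 0) P T V (V \<omega>)) 0 *
        pmf (cond_law (\<lambda>_. return_pmf 0) P T V (V \<omega>)) 1) =
      sqrt (pmf (cond_law (\<lambda>_. return_pmf 0) P T V' (V' \<omega>)) 0 *
        pmf (cond_law (\<lambda>_. return_pmf 0) P T V' (V' \<omega>)) 1)"
      unfolding AE_measure_pmf_iff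
      by (intro ballI arg_cong[where f = sqrt] arg_cong2[where f = "(*)"] eq)
  qed simp_all
  then show ?thesis
    unfolding bhattacharyya_eq_expectation[where d = "\<lambda>_. return_pmf 0"]
    by (simp only:)
qed

text \<open>If \<open>T\<close> has conditional law \<open>(a, b)\<close>, an independent sample
  from that law misses it with probability \<open>2 * (a * b)\<close>. Since \<open>a * b\<close> is
  at most 1/4, this is at most \<open>sqrt (a * b)\<close>, whose mean is half the
  parameter.\<close>

lemma low_bhattacharyya_error:
  fixes T :: "'w \<Rightarrow> bit"
  assumes "bhattacharyya P T V \<le> \<delta>"
  shows "measure_pmf.expectation P (\<lambda>\<omega>. 1 - pmf (cond_law d P T V (V \<omega>)) (T \<omega>)) \<le> \<delta> / 2"
proof -
  let ?q = "\<lambda>\<omega>. cond_law d P T V (V \<omega>)"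
  have le: "2 * (a * b) \<le> sqrt (a * b)" if "0 \<le> a" "0 \<le> b" "a + b = 1" for a b :: real
  proof -
    have "4 * (a * b) = (a + b)^2 - (a - b)^2"
      by (simp add: power2_eq_square algebra_simps)
    then have "4 * (a * b) \<le> 1"
      using that by simp
    then have "(2 * (a * b))^2 \<le> a * b"
      using mult_right_mono[of "4 * (a * b)" 1 "a * b"] that by (simp add: power2_eq_square ac_simps)
    then show ?thesis
      by (rule real_le_rsqrt)
  qed
  have "measure_pmf.expectation P (\<lambda>\<omega>. 1 - pmf (?q \<omega>) (T \<omega>)) =
      measure_pmf.expectation P (\<lambda>\<omega>. measure_pmf.expectation (?q \<omega>) (\<lambda>t. 1 - pmf (?q \<omega>) t))"
    by (rule expectation_cond_law[of "\<lambda>v t. 1 - pmf (cond_law d P T V v) t" 1]) (simp add: pmf_le_1)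
  also have "\<dots> = measure_pmf.expectation P (\<lambda>\<omega>. 2 * (pmf (?q \<omega>) 0 * pmf (?q \<omega>) 1))"
    by (simp add: expectation_bit pmf_bit_0 algebra_simps)
  also have "\<dots> \<le> measure_pmf.expectation P (\<lambda>\<omega>. sqrt (pmf (?q \<omega>) 0 * pmf (?q \<omega>) 1))"
    by (rule expectation_pmf_mono[of _ _ _ 2 1])
      (auto intro!: le simp: pmf_bit_0 pmf_le_1 mult_le_one abs_mult)
  also have "\<dots> \<le> \<delta> / 2"
    using assms by (simp add: bhattacharyya_eq_expectation[where d = d])
  finally show ?thesis .
qed

text \<open>Jensen's inequality for the square root, read off from the nonnegative variance of
  \<open>sqrt (f x)\<close>.\<close>

lemma expectation_sqrt_le:
  fixes f :: "'a \<Rightarrow> real"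
  assumes "\<And>x. 0 \<le> f x \<and> f x \<le> 1"
  shows "measure_pmf.expectation M (\<lambda>x. sqrt (f x)) \<le> sqrt (measure_pmf.expectation M f)"
proof (rule real_le_rsqrt)
  have s: "integrable M (\<lambda>x. sqrt (f x))"
    by (rule integrable_pmf_bounded[of _ 1]) (use assms in auto)
  moreover have "integrable M (\<lambda>x. (sqrt (f x))\<^sup>2)"
    by (rule integrable_pmf_bounded[of _ 1]) (use assms in auto)
  ultimately have "(measure_pmf.expectation M (\<lambda>x. sqrt (f x)))\<^sup>2 \<le>
      measure_pmf.expectation M (\<lambda>x. (sqrt (f x))\<^sup>2)"
    using measure_pmf.variance_positive[of M "\<lambda>x. sqrt (f x)"]
    by (simp add: measure_pmf.variance_eq)
  with assms show "(measure_pmf.expectation M (\<lambda>x. sqrt (f x)))\<^sup>2 \<le> measure_pmf.expectation M f"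
    by simp
qed

text \<open>With \<open>z\<close> twice the geometric mean of the two conditional probabilities, the
  squared bias is \<open>(1 - z\<^sup>2) / 4\<close>, at most \<open>(1 - z) / 2\<close>. Jensen
  then brings in the mean of \<open>z\<close>, which is the parameter. This is the origin of the
  square root in the final bound.\<close>

lemma high_bhattacharyya_uniform:
  fixes T :: "'w \<Rightarrow> bit"
  assumes "1 - \<delta> \<le> bhattacharyya P T V"
  shows "measure_pmf.expectation P (\<lambda>\<omega>. \<bar>pmf (cond_law d P T V (V \<omega>)) 1 - 1 / 2\<bar>) \<le> sqrt (\<delta> / 2)"
proof -
  define z where "z = (\<lambda>\<omega>. 2 * sqrt (pmf (cond_law d P T V (V \<omega>)) 0 * pmf (cond_law d P T V (V \<omega>)) 1))"
  have z1: "0 \<le> z \<omega> \<and> z \<omega> \<le> 1" for \<omega>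
  proof -
    let ?a = "pmf (cond_law d P T V (V \<omega>)) 1"
    have "4 * ((1 - ?a) * ?a) = 1 - (1 - 2 * ?a)^2"
      by (simp add: power2_eq_square algebra_simps)
    then have "4 * ((1 - ?a) * ?a) \<le> 1"
      by simp
    then have "sqrt (4 * ((1 - ?a) * ?a)) \<le> 1"
      by simp
    then show ?thesis
      by (simp add: z_def pmf_bit_0 real_sqrt_mult pmf_le_1)
  qed
  have le: "\<bar>pmf (cond_law d P T V (V \<omega>)) 1 - 1 / 2\<bar> \<le> sqrt ((1 - z \<omega>) / 2)" for \<omega>
  proof (rule real_le_rsqrt)
    let ?a = "pmf (cond_law d P T V (V \<omega>)) 1"
    have "\<bar>?a - 1 / 2\<bar>\<^sup>2 = (1 - 4 * ((1 - ?a) * ?a)) / 4"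
      by (simp add: power2_eq_square field_simps)
    also have "4 * ((1 - ?a) * ?a) = (z \<omega>)\<^sup>2"
      by (simp add: z_def power_mult_distrib pmf_bit_0 pmf_le_1)
    also have "(1 - (z \<omega>)\<^sup>2) / 4 \<le> (1 - z \<omega>) / 2"
    proof -
      have "1 - (z \<omega>)\<^sup>2 = (1 - z \<omega>) * (1 + z \<omega>)"
        by (simp add: power2_eq_square algebra_simps)
      also have "\<dots> \<le> (1 - z \<omega>) * 2"
        using z1[of \<omega>] by (intro mult_left_mono) auto
      finally show ?thesis by simp
    qed
    finally show "\<bar>?a - 1 / 2\<bar>\<^sup>2 \<le> (1 - z \<omega>) / 2" .
  qed
  have "\<bar>\<bar>pmf q 1 - 1 / 2\<bar>\<bar> \<le> 1" for q :: "bit pmf"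
    using pmf_nonneg[of q 1] pmf_le_1[of q 1] by linarith
  moreover have "\<bar>sqrt ((1 - z \<omega>) / 2)\<bar> \<le> 1" for \<omega>
    using z1[of \<omega>] by simp
  ultimately have "measure_pmf.expectation P (\<lambda>\<omega>. \<bar>pmf (cond_law d P T V (V \<omega>)) 1 - 1 / 2\<bar>) \<le>
      measure_pmf.expectation P (\<lambda>\<omega>. sqrt ((1 - z \<omega>) / 2))"
    by (rule expectation_pmf_mono[OF le])
  also have "\<dots> \<le> sqrt (measure_pmf.expectation P (\<lambda>\<omega>. (1 - z \<omega>) / 2))"
  proof (rule expectation_sqrt_le)
    fix \<omega>
    show "0 \<le> (1 - z \<omega>) / 2 \<and> (1 - z \<omega>) / 2 \<le> 1"
      using z1[of \<omega>] by simp
  qed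
  also have "measure_pmf.expectation P (\<lambda>\<omega>. (1 - z \<omega>) / 2) = (1 - bhattacharyya P T V) / 2"
  proof -
    have "integrable P z"
      by (rule integrable_pmf_bounded[of _ 1]) (use z1 in auto)
    then have "measure_pmf.expectation P (\<lambda>\<omega>. (1 - z \<omega>) / 2) = (1 - measure_pmf.expectation P z) / 2"
      by simp
    also have "measure_pmf.expectation P z = bhattacharyya P T V"
      unfolding z_def bhattacharyya_eq_expectation[where d = d]
      by (rule integral_mult_right_zero)
    finally show ?thesis .
  qed
  also have "sqrt \<dots> \<le> sqrt (\<delta> / 2)"
    using assms by simp
  finally show ?thesis .
qed

section \<open>Total variation\<close>

text \<open>Total variation, dually: no test function with values in \<open>[0, 1]\<close> gains more than \<open>e\<close>.\<close>

definition tv_within :: "real \<Rightarrow> 'a pmf \<Rightarrow> 'a pmf \<Rightarrow> bool" where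
  "tv_within e q p \<longleftrightarrow> (\<forall>f :: 'a \<Rightarrow> real. (\<forall>x. 0 \<le> f x \<and> f x \<le> 1) \<longrightarrow>
     measure_pmf.expectation q f - measure_pmf.expectation p f \<le> e)"

lemma tv_withinI:
  assumes "\<And>f :: 'a \<Rightarrow> real. (\<And>x. 0 \<le> f x \<and> f x \<le> 1) \<Longrightarrow>
    measure_pmf.expectation q f - measure_pmf.expectation p f \<le> e"
  shows "tv_within e q p"
  using assms by (auto simp: tv_within_def)

lemma tv_withinD:
  assumes "tv_within e q p" "\<And>x. 0 \<le> f x \<and> f x \<le> 1"
  shows "measure_pmf.expectation q f - measure_pmf.expectation p f \<le> e"
  using assms by (auto simp: tv_within_def)

lemma tv_within_refl: "0 \<le> e \<Longrightarrow> tv_within e p p"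
  by (auto intro: tv_withinI)

lemma tv_within_mono: "tv_within e q p \<Longrightarrow> e \<le> e' \<Longrightarrow> tv_within e' q p"
  unfolding tv_within_def by (meson order_trans)

lemma tv_within_trans:
  assumes "tv_within e1 q r" "tv_within e2 r p"
  shows "tv_within (e1 + e2) q p"
proof (rule tv_withinI)
  fix f :: "'a \<Rightarrow> real"
  assume f: "\<And>x. 0 \<le> f x \<and> f x \<le> 1"
  from tv_withinD[where f = f, OF assms(1) f] tv_withinD[where f = f, OF assms(2) f]
  show "measure_pmf.expectation q f - measure_pmf.expectation p f \<le> e1 + e2"
    by linarith
qed

text \<open>Data processing: averaging a test function over \<open>K\<close> gives a test function
  of the input.\<close>

lemma tv_within_bind_left:
  fixes K :: "'a \<Rightarrow> 'b pmf" and q p :: "'a pmf"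
  assumes "tv_within e q p"
  shows "tv_within e (q \<bind> K) (p \<bind> K)"
proof (rule tv_withinI)
  fix f :: "'b \<Rightarrow> real"
  assume f: "\<And>x. 0 \<le> f x \<and> f x \<le> 1"
  then have "\<bar>f x\<bar> \<le> 1" for x
    by auto
  note bind = expectation_bind_pmf[where f = f, OF this]
  have "0 \<le> measure_pmf.expectation (K x) f \<and> measure_pmf.expectation (K x) f \<le> 1" for x
    by (rule expectation_pmf_bounds[where f = f, OF f])
  from tv_withinD[where f = "\<lambda>x. measure_pmf.expectation (K x) f", OF assms this]
  show "measure_pmf.expectation (q \<bind> K) f - measure_pmf.expectation (p \<bind> K) f \<le> e"
    by (simp add: bind)
qed

lemma tv_within_map: "tv_within e q p \<Longrightarrow> tv_within e (map_pmf g q) (map_pmf g p)"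
  unfolding map_pmf_def by (rule tv_within_bind_left)

text \<open>With a common input law the errors are averaged, not maximized. This is what lets bounds
  on expectations replace bounds valid for every prefix. The bound \<open>B\<close> only secures
  integrability.\<close>

lemma tv_within_bind_right:
  fixes K L :: "'a \<Rightarrow> 'b pmf" and M :: "'a pmf"
  assumes "\<And>x. x \<in> set_pmf M \<Longrightarrow> tv_within (e x) (K x) (L x)" "\<And>x. \<bar>e x\<bar> \<le> B"
  shows "tv_within (measure_pmf.expectation M e) (M \<bind> K) (M \<bind> L)"
proof (rule tv_withinI)
  fix f :: "'b \<Rightarrow> real"
  assume f: "\<And>x. 0 \<le> f x \<and> f x \<le> 1"
  then have f': "\<bar>f x\<bar> \<le> 1" for x
    by auto
  have i: "integrable M (\<lambda>x. measure_pmf.expectation (N x) f)" for N :: "'a \<Rightarrow> 'b pmf"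
  proof (rule integrable_pmf_bounded[of _ 1])
    fix x
    show "\<bar>measure_pmf.expectation (N x) f\<bar> \<le> 1"
      using expectation_pmf_bounds[where f = f and M = "N x", OF f] by simp
  qed
  have "measure_pmf.expectation (M \<bind> K) f - measure_pmf.expectation (M \<bind> L) f =
      measure_pmf.expectation M
        (\<lambda>x. measure_pmf.expectation (K x) f - measure_pmf.expectation (L x) f)"
    using i by (simp add: expectation_bind_pmf[where f = f, OF f'])
  also have "\<dots> \<le> measure_pmf.expectation M e"
    by (rule integral_mono_AE)
      (use i tv_withinD[where f = f, OF assms(1) f] integrable_pmf_bounded[where f = e, OF assms(2)]
        in \<open>auto simp: AE_measure_pmf_iff\<close>)
  finally show "measure_pmf.expectation (M \<bind> K) f - measure_pmf.expectation (M \<bind> L) f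
    \<le> measure_pmf.expectation M e" .
qed

lemma tv_within_return:
  "tv_within (1 - pmf q x) q (return_pmf x)"
proof (rule tv_withinI)
  fix f :: "'a \<Rightarrow> real"
  assume f: "\<And>x. 0 \<le> f x \<and> f x \<le> 1"
  \<comment> \<open>Bounding \<open>f\<close> by 1 away from \<open>x\<close> shows that only the
    mass of \<open>q\<close> outside \<open>x\<close> can gain.\<close>
  have "measure_pmf.expectation q f \<le> measure_pmf.expectation q (\<lambda>y. 1 - (1 - f x) * indicator {x} y)"
    by (rule expectation_pmf_mono[of _ _ _ 1 1]) (use f in \<open>auto simp: indicator_def\<close>)
  also have "\<dots> = 1 - (1 - f x) * pmf q x"
    by (simp add: measure_pmf_single integrable_pmf_bounded[of _ 1])
  also have "\<dots> - f x \<le> 1 - pmf q x"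
  proof -
    have "0 \<le> f x * (1 - pmf q x)"
      using f[of x] by (simp add: pmf_le_1)
    then show ?thesis
      by (simp add: algebra_simps)
  qed
  finally show "measure_pmf.expectation q f - measure_pmf.expectation (return_pmf x) f \<le> 1 - pmf q x"
    by simp
qed

text \<open>The independent coupling: two laws differ by at most the probability that independent
  samples disagree. Drawing \<open>x\<close> from \<open>p\<close> first, one compares
  \<open>q\<close> with the point mass at \<open>x\<close> and averages.\<close>

lemma tv_within_expected_error:
  "tv_within (measure_pmf.expectation p (\<lambda>x. 1 - pmf q x)) q p"
proof -
  have "tv_within (measure_pmf.expectation p (\<lambda>x. 1 - pmf q x)) (p \<bind> (\<lambda>_. q)) (p \<bind> return_pmf)"
    by (rule tv_within_bind_right[where B = 1]) (auto simp: tv_within_return pmf_le_1)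
  then show ?thesis
    by (simp add: bind_return_pmf')
qed

lemma tv_within_bit: "tv_within \<bar>pmf q 1 - pmf p 1\<bar> q (p :: bit pmf)"
proof (rule tv_withinI)
  fix f :: "bit \<Rightarrow> real"
  assume f: "\<And>x. 0 \<le> f x \<and> f x \<le> 1"
  have "measure_pmf.expectation q f - measure_pmf.expectation p f = (pmf q 1 - pmf p 1) * (f 1 - f 0)"
    by (simp add: expectation_bit algebra_simps)
  also have "\<dots> \<le> \<bar>pmf q 1 - pmf p 1\<bar> * \<bar>f 1 - f 0\<bar>"
    by (simp flip: abs_mult)
  also have "\<dots> \<le> \<bar>pmf q 1 - pmf p 1\<bar> * 1"
    using f[of 0] f[of 1] by (intro mult_left_mono) auto
  finally show "measure_pmf.expectation q f - measure_pmf.expectation p f \<le> \<bar>pmf q 1 - pmf p 1\<bar>"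
    by simp
qed

lemma l1_dist_le:
  assumes "tv_within e q p"
  shows "l1_dist q p \<le> 2 * e"
proof -
  define A where "A = {x. pmf p x < pmf q x}"
  \<comment> \<open>The sign of the difference of the masses; a tie gets -1, where the difference is
    zero anyway. Rewriting the sign through the indicator of \<open>A\<close> produces the factor
    2.\<close>
  define f :: "'a \<Rightarrow> real" where "f = (\<lambda>x. 2 * indicator A x - 1)"
  have f: "\<bar>f x\<bar> \<le> 1" for x
    by (simp add: f_def indicator_def)
  have "((\<lambda>x. pmf q x * f x + - (pmf p x * f x)) has_sum
      (measure_pmf.expectation q f + - measure_pmf.expectation p f)) UNIV"
    by (intro has_sum_add has_sum_expectation_pmf[where f = f, OF f])
      (simp add: has_sum_uminus has_sum_expectation_pmf[where f = f, OF f])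
  then have "l1_dist q p = measure_pmf.expectation q f - measure_pmf.expectation p f"
    unfolding l1_dist_def
    by (intro infsumI) (auto simp: f_def A_def indicator_def abs_if algebra_simps
        elim!: has_sum_cong[THEN iffD1, rotated])
  also have "\<dots> = 2 * (measure_pmf.expectation q (indicator A) - measure_pmf.expectation p (indicator A))"
    by (simp add: f_def integrable_pmf_bounded[of _ 1] del: Bochner_Integration.integral_indicator)
  also have "\<dots> \<le> 2 * e"
    using tv_withinD[OF assms, of "indicator A"] by (simp add: indicator_def)
  finally show ?thesis .
qed

lemma l1_dist_nonneg: "0 \<le> l1_dist q p"
  unfolding l1_dist_def by (rule infsum_nonneg) simp

lemma tv_within_prob:
  assumes "tv_within e q p"
  shows "measure_pmf.prob q A \<le> measure_pmf.prob p A + e"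
  using tv_withinD[OF assms, of "indicator A"] by (simp add: indicator_def)

section \<open>Sequential sampling\<close>

lemma map_bind_Pair:
  "map_pmf (\<lambda>(x, y). (f x, g y)) (bind_pmf M (\<lambda>x. map_pmf (Pair x) (K x))) =
    bind_pmf M (\<lambda>x. map_pmf (Pair (f x)) (map_pmf g (K x)))"
  by (simp add: map_bind_pmf pmf.map_comp o_def)

lemma length_sample_bits: "v \<in> set_pmf (sample_bits K m) \<Longrightarrow> length v = m"
  by (induction m arbitrary: v) auto

lemma sample_bits_Suc:
  "sample_bits K (Suc m) = bind_pmf (sample_bits K m) (\<lambda>v. map_pmf (\<lambda>b. v @ [b]) (K v))"
  by (simp add: map_pmf_def)

lemma sample_bits_cong:
  assumes "\<And>v. length v < m \<Longrightarrow> K v = L v"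
  shows "sample_bits K m = sample_bits L m"
  using assms
proof (induction m)
  case (Suc m)
  then have "sample_bits K m = sample_bits L m"
    by simp
  then show ?case
    unfolding sample_bits_Suc
    by (intro bind_pmf_cong) (auto simp: Suc.prems dest!: length_sample_bits)
qed simp

text \<open>The chain rule of probability in the presence of side information \<open>C\<close>: each
  bit follows its conditional law given \<open>C\<close> and the earlier bits. Prefixes are covered
  since the exchange of kernels stops at each position in turn.\<close>

lemma chain_rule_sample_bits:
  fixes C :: "'w \<Rightarrow> 'c" and V :: "'w \<Rightarrow> bit list"
  assumes len: "\<And>\<omega>. \<omega> \<in> set_pmf P \<Longrightarrow> length (V \<omega>) = N" and "m \<le> N"
  shows "map_pmf (\<lambda>\<omega>. (C \<omega>, take m (V \<omega>))) P =
    bind_pmf (map_pmf C P) (\<lambda>c. map_pmf (Pair c) (sample_bits (\<lambda>v. cond_law d P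
      (\<lambda>\<omega>. V \<omega> ! length v) (\<lambda>\<omega>. (take (length v) (V \<omega>), C \<omega>)) (v, c)) m))"
  using \<open>m \<le> N\<close>
proof (induction m)
  case 0
  then show ?case
    by (simp add: map_pmf_def bind_assoc_pmf bind_return_pmf)
next
  case (Suc m)
  let ?K = "\<lambda>c v. cond_law d P (\<lambda>\<omega>. V \<omega> ! length v) (\<lambda>\<omega>. (take (length v) (V \<omega>), C \<omega>)) (v, c)"
  have "map_pmf (\<lambda>\<omega>. (C \<omega>, take (Suc m) (V \<omega>))) P =
      map_pmf (\<lambda>((v, c), b). (c, v @ [b])) (map_pmf (\<lambda>\<omega>. ((take m (V \<omega>), C \<omega>), V \<omega> ! m)) P)"
    unfolding pmf.map_comp using Suc.prems
    by (intro map_pmf_cong refl) (simp add: len take_Suc_conv_app_nth)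
  also have "\<dots> = bind_pmf (map_pmf (\<lambda>\<omega>. (take m (V \<omega>), C \<omega>)) P) (\<lambda>(v, c). map_pmf (\<lambda>b. (c, v @ [b]))
      (cond_law d P (\<lambda>\<omega>. V \<omega> ! m) (\<lambda>\<omega>. (take m (V \<omega>), C \<omega>)) (v, c)))"
    unfolding disintegrate_cond_law[of "\<lambda>\<omega>. (take m (V \<omega>), C \<omega>)" "\<lambda>\<omega>. V \<omega> ! m" P d]
    by (simp add: map_bind_pmf pmf.map_comp o_def case_prod_unfold)
  also have "\<dots> = bind_pmf (map_pmf (\<lambda>\<omega>. (C \<omega>, take m (V \<omega>))) P) (\<lambda>(c, v). map_pmf (\<lambda>b. (c, v @ [b]))
      (cond_law d P (\<lambda>\<omega>. V \<omega> ! m) (\<lambda>\<omega>. (take m (V \<omega>), C \<omega>)) (v, c)))"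
    by (simp add: bind_map_pmf)
  also have "\<dots> = bind_pmf (map_pmf C P) (\<lambda>c. bind_pmf (sample_bits (?K c) m) (\<lambda>v. map_pmf (\<lambda>b. (c, v @ [b]))
      (cond_law d P (\<lambda>\<omega>. V \<omega> ! m) (\<lambda>\<omega>. (take m (V \<omega>), C \<omega>)) (v, c))))"
    using Suc by (simp add: bind_assoc_pmf bind_map_pmf)
  also have "\<dots> = bind_pmf (map_pmf C P) (\<lambda>c. map_pmf (Pair c) (sample_bits (?K c) (Suc m)))"
    unfolding sample_bits_Suc map_bind_pmf pmf.map_comp o_def
    by (intro bind_pmf_cong refl) (auto dest!: length_sample_bits)
  finally show ?case .
qed

text \<open>Conditional independence in kernel form: given \<open>B\<close> and \<open>Z\<close>,
  the law of \<open>A\<close> is found from \<open>B\<close> alone. Where \<open>b\<close> has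
  probability zero, both sides vanish.\<close>

lemma markov_chain_kernel:
  fixes A :: "'w \<Rightarrow> 'a" and B :: "'w \<Rightarrow> 'b" and Z :: "'w \<Rightarrow> 'c"
  assumes "markov_chain p A B Z"
  shows "map_pmf (\<lambda>\<omega>. ((B \<omega>, Z \<omega>), A \<omega>)) p =
    bind_pmf (map_pmf (\<lambda>\<omega>. (B \<omega>, Z \<omega>)) p) (\<lambda>x. map_pmf (Pair x) (cond_law d p A B (fst x)))"
proof (rule pmf_eqI)
  fix bza :: "('b \<times> 'c) \<times> 'a"
  obtain b z a where bza: "bza = ((b, z), a)"
    by (cases bza) (metis surj_pair)
  let ?prob = "measure_pmf.prob p"
  have lhs: "pmf (map_pmf (\<lambda>\<omega>. ((B \<omega>, Z \<omega>), A \<omega>)) p) ((b, z), a) = ?prob {\<omega>. (A \<omega> = a \<and> Z \<omega> = z) \<and> B \<omega> = b}"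
    by (auto simp: pmf_map intro!: arg_cong[where f = ?prob])
  have bz: "pmf (map_pmf (\<lambda>\<omega>. (B \<omega>, Z \<omega>)) p) (b, z) = ?prob {\<omega>. Z \<omega> = z \<and> B \<omega> = b}"
    by (auto simp: pmf_map intro!: arg_cong[where f = ?prob])
  have "?prob {\<omega>. (A \<omega> = a \<and> Z \<omega> = z) \<and> B \<omega> = b} =
      ?prob {\<omega>. Z \<omega> = z \<and> B \<omega> = b} * pmf (cond_law d p A B b) a"
  proof (cases "b \<in> set_pmf (map_pmf B p)")
    case True
    then have ne: "?prob {\<omega>. B \<omega> = b} \<noteq> 0"
      by (auto simp: measure_pmf_zero_iff)
    have "\<P>(\<omega> in measure_pmf p. A \<omega> = a \<and> Z \<omega> = z \<bar> B \<omega> = b) =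
        pmf (cond_law d p A B b) a * \<P>(\<omega> in measure_pmf p. Z \<omega> = z \<bar> B \<omega> = b)"
      using assms True cond_prob_eq_pmf_cond_law[OF True, of A a d] by (simp add: markov_chain_def)
    with ne show ?thesis
      by (simp add: cond_prob_def field_simps)
  next
    case False
    then have "?prob {\<omega>. B \<omega> = b} = 0"
      by (auto simp: measure_pmf_zero_iff)
    moreover have "?prob {\<omega>. (A \<omega> = a \<and> Z \<omega> = z) \<and> B \<omega> = b} \<le> ?prob {\<omega>. B \<omega> = b}"
      "?prob {\<omega>. Z \<omega> = z \<and> B \<omega> = b} \<le> ?prob {\<omega>. B \<omega> = b}"
      by (auto intro!: measure_pmf.finite_measure_mono)
    ultimately show ?thesis
      by (simp add: measure_le_0_iff)
  qed
  then show "pmf (map_pmf (\<lambda>\<omega>. ((B \<omega>, Z \<omega>), A \<omega>)) p) bza =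
    pmf (bind_pmf (map_pmf (\<lambda>\<omega>. (B \<omega>, Z \<omega>)) p) (\<lambda>x. map_pmf (Pair x) (cond_law d p A B (fst x)))) bza"
    unfolding bza pmf_bind_Pair lhs bz by simp
qed

text \<open>The memoryless extension of the channel \<open>k\<close> to blocks.\<close>

primrec map_kernel :: "('a \<Rightarrow> 'b pmf) \<Rightarrow> 'a list \<Rightarrow> 'b list pmf" where
  "map_kernel k [] = return_pmf []"
| "map_kernel k (x # xs) =
     bind_pmf (k x) (\<lambda>y. bind_pmf (map_kernel k xs) (\<lambda>ys. return_pmf (y # ys)))"

lemma map_replicate_pmf: "map_pmf (map f) (replicate_pmf m p) = replicate_pmf m (map_pmf f p)"
proof (induction m)
  case (Suc m)
  show ?case
    by (simp add: map_bind_pmf bind_map_pmf flip: Suc.IH)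
qed simp

lemma replicate_pmf_map_kernel:
  assumes "map_pmf (\<lambda>\<omega>. (D \<omega>, A \<omega>)) p = bind_pmf (map_pmf D p) (\<lambda>d. map_pmf (Pair d) (k d))"
  shows "map_pmf (\<lambda>\<omega>s. (map D \<omega>s, map A \<omega>s)) (replicate_pmf m p) =
    bind_pmf (map_pmf (map D) (replicate_pmf m p)) (\<lambda>ds. map_pmf (Pair ds) (map_kernel k ds))"
proof (induction m)
  case 0
  then show ?case
    by (simp add: bind_return_pmf)
next
  case (Suc m)
  let ?R = "replicate_pmf m p"
  have "map_pmf (\<lambda>\<omega>s. (map D \<omega>s, map A \<omega>s)) (replicate_pmf (Suc m) p) =
      bind_pmf (map_pmf (\<lambda>\<omega>. (D \<omega>, A \<omega>)) p) (\<lambda>(d, a).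
        bind_pmf (map_pmf (\<lambda>\<omega>s. (map D \<omega>s, map A \<omega>s)) ?R) (\<lambda>(ds, as). return_pmf (d # ds, a # as)))"
    by (simp add: map_bind_pmf bind_map_pmf)
  also have "\<dots> = bind_pmf (map_pmf D p) (\<lambda>d. bind_pmf (k d) (\<lambda>a.
      bind_pmf (map_pmf (map D) ?R) (\<lambda>ds. bind_pmf (map_kernel k ds) (\<lambda>as. return_pmf (d # ds, a # as)))))"
    unfolding Suc.IH assms by (simp add: bind_assoc_pmf bind_map_pmf)
  \<comment> \<open>The first output and the remaining inputs are drawn independently; swapping them
    puts all inputs before all outputs.\<close>
  also have "\<dots> = bind_pmf (map_pmf D p) (\<lambda>d. bind_pmf (map_pmf (map D) ?R) (\<lambda>ds.
      bind_pmf (k d) (\<lambda>a. bind_pmf (map_kernel k ds) (\<lambda>as. return_pmf (d # ds, a # as)))))"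
    by (subst bind_commute_pmf) (rule refl)
  also have "\<dots> = bind_pmf (map_pmf (map D) (replicate_pmf (Suc m) p))
      (\<lambda>ds. map_pmf (Pair ds) (map_kernel k ds))"
    by (simp add: map_bind_pmf bind_map_pmf bind_assoc_pmf bind_return_pmf)
  finally show ?case .
qed

text \<open>\<open>EV\<close> says that the law of \<open>V\<close> given \<open>E\<close> depends
  only on the part \<open>c\<close>, through some kernel \<open>L\<close>. Pushing forward along
  \<open>c\<close> makes \<open>L\<close> a conditional law given that part, so by uniqueness it
  agrees there with any known one, \<open>S\<close>.\<close>

lemma kernel_of_part:
  assumes EV: "map_pmf (\<lambda>\<omega>. (E \<omega>, V \<omega>)) P = bind_pmf (map_pmf E P) (\<lambda>e. map_pmf (Pair e) (L (c e)))"
    and CV: "map_pmf (\<lambda>\<omega>. (c (E \<omega>), V \<omega>)) P =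
      bind_pmf (map_pmf (\<lambda>\<omega>. c (E \<omega>)) P) (\<lambda>x. map_pmf (Pair x) (S x))"
  shows "map_pmf (\<lambda>\<omega>. (E \<omega>, V \<omega>)) P = bind_pmf (map_pmf E P) (\<lambda>e. map_pmf (Pair e) (S (c e)))"
proof -
  have "map_pmf (\<lambda>\<omega>. (c (E \<omega>), V \<omega>)) P = map_pmf (\<lambda>(x, y). (c x, y)) (map_pmf (\<lambda>\<omega>. (E \<omega>, V \<omega>)) P)"
    by (simp add: pmf.map_comp o_def)
  also have "\<dots> = bind_pmf (map_pmf (\<lambda>\<omega>. c (E \<omega>)) P) (\<lambda>x. map_pmf (Pair x) (L x))"
    unfolding EV by (simp add: map_bind_pmf bind_map_pmf pmf.map_comp o_def)
  finally have "L x = S x" if "x \<in> set_pmf (map_pmf (\<lambda>\<omega>. c (E \<omega>)) P)" for x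
    using that unfolding CV by (rule bind_Pair_unique[symmetric])
  then show ?thesis
    unfolding EV by (intro bind_pmf_cong) auto
qed

text \<open>Bits drawn in advance can as well be drawn when their position is reached, because the
  family \<open>r\<close> can be read back from the finished word. Elsewhere it takes the default 0
  of \<open>Pi_pmf\<close>.\<close>

lemma shared_bits_sample_bits:
  fixes F :: "nat set" and K :: "bit list \<Rightarrow> bit pmf" and D :: "bit pmf"
  defines "G \<equiv> \<lambda>r v. if length v \<in> F then return_pmf (r (length v)) else K v"
    and "G' \<equiv> \<lambda>v. if length v \<in> F then D else K v"
  shows "bind_pmf (Pi_pmf (F \<inter> {..<m}) 0 (\<lambda>_. D)) (\<lambda>r. map_pmf (Pair r) (sample_bits (G r) m)) =
    map_pmf (\<lambda>v. (\<lambda>j. if j \<in> F \<inter> {..<m} then v ! j else 0, v)) (sample_bits G' m)"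
proof (induction m)
  case 0
  then show ?case
    by (simp add: bind_return_pmf)
next
  case (Suc m)
  let ?Pi = "Pi_pmf (F \<inter> {..<m}) 0 (\<lambda>_. D)"
  let ?r = "\<lambda>m v j. if j \<in> F \<inter> {..<m} then v ! j else 0"
  show ?case
  proof (cases "m \<in> F")
    case False
    then have F: "F \<inter> {..<Suc m} = F \<inter> {..<m}"
      by (auto simp: less_Suc_eq)
    have "bind_pmf ?Pi (\<lambda>r. map_pmf (Pair r) (sample_bits (G r) (Suc m))) =
        bind_pmf ?Pi (\<lambda>r. bind_pmf (sample_bits (G r) m) (\<lambda>v. map_pmf (\<lambda>b. (r, v @ [b])) (K v)))"
      unfolding sample_bits_Suc map_bind_pmf pmf.map_comp o_def
      by (intro bind_pmf_cong refl) (use False in \<open>auto simp: G_def dest!: length_sample_bits\<close>)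
    also have "\<dots> = bind_pmf (bind_pmf ?Pi (\<lambda>r. map_pmf (Pair r) (sample_bits (G r) m)))
        (\<lambda>(r, v). map_pmf (\<lambda>b. (r, v @ [b])) (K v))"
      by (simp add: bind_assoc_pmf bind_map_pmf)
    also have "\<dots> = bind_pmf (sample_bits G' m) (\<lambda>v. map_pmf (\<lambda>b. (?r m v, v @ [b])) (K v))"
      unfolding Suc.IH by (simp add: bind_map_pmf)
    also have "\<dots> = bind_pmf (sample_bits G' m)
        (\<lambda>v. map_pmf (\<lambda>b. (?r m (v @ [b]), v @ [b])) (G' v))"
      by (intro bind_pmf_cong map_pmf_cong refl)
        (use False in \<open>auto simp: G'_def nth_append dest!: length_sample_bits\<close>)
    finally show ?thesis
      unfolding F sample_bits_Suc map_bind_pmf pmf.map_comp o_def .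
  next
    case True
    then have F: "F \<inter> {..<Suc m} = insert m (F \<inter> {..<m})"
      by (auto simp: less_Suc_eq)
    \<comment> \<open>The first \<open>m\<close> bits do not consult \<open>r m\<close>, so its draw
      \<open>y\<close> can be postponed to position \<open>m\<close>.\<close>
    have G: "sample_bits (G (f(m := y))) m = sample_bits (G f) m" for f y
      by (rule sample_bits_cong) (simp add: G_def)
    have "bind_pmf (Pi_pmf (F \<inter> {..<Suc m}) 0 (\<lambda>_. D)) (\<lambda>r. map_pmf (Pair r) (sample_bits (G r) (Suc m))) =
        bind_pmf D (\<lambda>y. bind_pmf ?Pi (\<lambda>f. map_pmf (Pair (f(m := y))) (sample_bits (G (f(m := y))) (Suc m))))"
      unfolding F by (subst Pi_pmf_insert') (auto simp: bind_assoc_pmf bind_return_pmf)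
    also have "\<dots> = bind_pmf D (\<lambda>y. bind_pmf ?Pi (\<lambda>f. bind_pmf (sample_bits (G f) m)
        (\<lambda>v. return_pmf (f(m := y), v @ [y]))))"
      unfolding sample_bits_Suc map_bind_pmf pmf.map_comp o_def G
      by (intro bind_pmf_cong refl) (use True in \<open>auto simp: G_def dest!: length_sample_bits\<close>)
    also have "\<dots> = bind_pmf ?Pi (\<lambda>f. bind_pmf (sample_bits (G f) m)
        (\<lambda>v. map_pmf (\<lambda>y. (f(m := y), v @ [y])) D))"
      by (simp add: map_pmf_def bind_commute_pmf[of D])
    also have "\<dots> = bind_pmf (bind_pmf ?Pi (\<lambda>r. map_pmf (Pair r) (sample_bits (G r) m)))
        (\<lambda>(f, v). map_pmf (\<lambda>y. (f(m := y), v @ [y])) D)"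
      by (simp add: bind_assoc_pmf bind_map_pmf)
    also have "\<dots> = bind_pmf (sample_bits G' m) (\<lambda>v. map_pmf (\<lambda>y. ((?r m v)(m := y), v @ [y])) D)"
      unfolding Suc.IH by (simp add: bind_map_pmf)
    also have "\<dots> = bind_pmf (sample_bits G' m)
        (\<lambda>v. map_pmf (\<lambda>b. (?r (Suc m) (v @ [b]), v @ [b])) (G' v))"
      by (intro bind_pmf_cong map_pmf_cong refl)
        (use True in \<open>auto simp: G'_def nth_append fun_eq_iff less_Suc_eq dest!: length_sample_bits\<close>)
    finally show ?thesis
      unfolding sample_bits_Suc map_bind_pmf pmf.map_comp o_def .
  qed
qed

text \<open>A telescoping of hybrid laws that follow \<open>L\<close> up to some position and
  \<open>K\<close> afterwards. Each hypothesis concerns a single bit behind a prefix sampled from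
  \<open>L\<close>, hence an average over ideal prefixes.\<close>

lemma tv_within_sample_bits_averaged:
  fixes K L :: "'m \<Rightarrow> bit list \<Rightarrow> bit pmf"
  assumes "\<And>j. j < N \<Longrightarrow> tv_within (\<epsilon> j)
    (bind_pmf (bind_pmf M (\<lambda>m. map_pmf (Pair m) (sample_bits (L m) j)))
      (\<lambda>(m, v). map_pmf (\<lambda>b. (m, v @ [b])) (K m v)))
    (bind_pmf M (\<lambda>m. map_pmf (Pair m) (sample_bits (L m) (Suc j))))"
  shows "tv_within (\<Sum>j<N. \<epsilon> j) (bind_pmf M (\<lambda>m. map_pmf (Pair m) (sample_bits (K m) N)))
    (bind_pmf M (\<lambda>m. map_pmf (Pair m) (sample_bits (L m) N)))"
  using assms
proof (induction N)
  case 0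
  then show ?case
    by (simp add: tv_within_refl)
next
  case (Suc N)
  have "bind_pmf M (\<lambda>m. map_pmf (Pair m) (sample_bits (K m) (Suc N))) =
    bind_pmf (bind_pmf M (\<lambda>m. map_pmf (Pair m) (sample_bits (K m) N)))
      (\<lambda>(m, v). map_pmf (\<lambda>b. (m, v @ [b])) (K m v))"
    by (simp add: sample_bits_Suc map_bind_pmf bind_assoc_pmf bind_map_pmf pmf.map_comp o_def del: sample_bits.simps)
  moreover have "tv_within (\<Sum>j<N. \<epsilon> j) (bind_pmf M (\<lambda>m. map_pmf (Pair m) (sample_bits (K m) N)))
    (bind_pmf M (\<lambda>m. map_pmf (Pair m) (sample_bits (L m) N)))"
    by (rule Suc.IH) (rule Suc.prems, simp)
  note tv_within_trans[OF tv_within_bind_left[OF this] Suc.prems[OF lessI]]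
  ultimately show ?case
    by simp
qed

text \<open>A union bound over the place where sampling first leaves \<open>v\<close>; only prefixes
  of \<open>v\<close> are ever fed to \<open>K\<close>.\<close>

lemma tv_within_sample_bits_return:
  assumes "m \<le> length v"
  shows "tv_within (\<Sum>j<m. 1 - pmf (K (take j v)) (v ! j)) (sample_bits K m) (return_pmf (take m v))"
  using assms
proof (induction m)
  case 0
  then show ?case
    by (simp add: tv_within_refl)
next
  case (Suc m)
  let ?step = "\<lambda>w. map_pmf (\<lambda>b. w @ [b]) (K w)"
  have "tv_within (1 - pmf (K (take m v)) (v ! m)) (bind_pmf (return_pmf (take m v)) ?step)
      (return_pmf (take (Suc m) v))"
    using tv_within_map[OF tv_within_return, of "K (take m v)" "v ! m" "\<lambda>b. take m v @ [b]"] Suc.prems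
    by (simp add: bind_return_pmf take_Suc_conv_app_nth)
  moreover have "tv_within (\<Sum>j<m. 1 - pmf (K (take j v)) (v ! j)) (bind_pmf (sample_bits K m) ?step)
      (bind_pmf (return_pmf (take m v)) ?step)"
    by (rule tv_within_bind_left[OF Suc.IH]) (use Suc.prems in simp)
  ultimately show ?case
    unfolding sample_bits_Suc sum.lessThan_Suc by (intro tv_within_trans)
qed

section \<open>The protocol\<close>

lemma map_kernel_map: "map_kernel (\<lambda>d. k (g d)) ds = map_kernel k (map g ds)"
  by (induction ds) auto

text \<open>The polarization sets condition on a block of letters with side information, the
  sampling kernels on a tuple of blocks. Both layouts carry the same information.\<close>

lemma map_info_transpose_eq_iff:
  assumes "length ws = length ws'"
  shows "map (\<lambda>w. (a w, map (\<lambda>i. u i w) is)) ws = map (\<lambda>w. (a w, map (\<lambda>i. u i w) is)) ws' \<longleftrightarrow>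
    map a ws = map a ws' \<and> map (\<lambda>i. map (u i) ws) is = map (\<lambda>i. map (u i) ws') is"
  using assms by (induction ws ws' rule: list_induct2) auto

section \<open>Ideal words, histories, and the part of them each terminal sees\<close>

context
  fixes p :: "'w pmf" and X :: "'w \<Rightarrow> 'x" and Y :: "'w \<Rightarrow> 'y" and U :: "nat \<Rightarrow> 'w \<Rightarrow> bit"
    and \<beta> :: real and n :: nat
    and d0 :: "nat \<Rightarrow> bit list \<Rightarrow> bit pmf"
    and d1 :: "nat \<Rightarrow> bit list \<times> ('x + 'y) list \<times> bit list list \<Rightarrow> bit pmf"
begin

definition polar_word :: "nat \<Rightarrow> 'w list \<Rightarrow> bit list" where
  "polar_word l \<omega>s = polarize n (map (U l) \<omega>s)"

text \<open>Both sources are kept, although no terminal sees both, because the laws to be compared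
  involve both.\<close>

definition history :: "nat \<Rightarrow> 'w list \<Rightarrow> ('x \<times> 'y) list \<times> bit list list" where
  "history l \<omega>s = (map (\<lambda>\<omega>. (X \<omega>, Y \<omega>)) \<omega>s, map (\<lambda>i. map (U i) \<omega>s) [1..<l])"

definition view :: "terminal \<Rightarrow> ('x \<times> 'y) list \<times> bit list list \<Rightarrow> ('x + 'y) list \<times> bit list list" where
  "view s h = (map (observed s) (fst h), snd h)"

text \<open>Although the whole history is passed, only the view of \<open>s\<close> enters.\<close>

definition full_law :: "terminal \<Rightarrow> nat \<Rightarrow> ('x \<times> 'y) list \<times> bit list list \<Rightarrow> bit list \<Rightarrow> bit pmf" where
  "full_law s l h = side_law p X Y U n d1 s l (fst (view s h)) (snd (view s h))"

text \<open>The Markov chain of round \<open>l\<close> in a form common to both parities. Existence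
  of \<open>k\<close> suffices, since uniqueness of conditional laws later replaces it by the kernel
  of the protocol.\<close>

definition markov_kernel :: "nat \<Rightarrow> bool" where
  "markov_kernel l \<longleftrightarrow> (\<exists>k. map_pmf (\<lambda>\<omega>. (((X \<omega>, Y \<omega>), map (\<lambda>i. U i \<omega>) [1..<l]), U l \<omega>)) p =
     bind_pmf (map_pmf (\<lambda>\<omega>. ((X \<omega>, Y \<omega>), map (\<lambda>i. U i \<omega>) [1..<l])) p)
       (\<lambda>d. map_pmf (Pair d) (k (observed (transmitter l) (fst d), snd d))))"

lemma length_polar_word [simp]: "length (polar_word l \<omega>s) = 2 ^ n"
  by (simp add: polar_word_def)

lemma length_iid: "\<omega>s \<in> set_pmf (iid n p) \<Longrightarrow> length \<omega>s = 2 ^ n"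
  by (simp add: iid_def set_replicate_pmf)

lemma polar_bit_eq: "polar_bit n (U l) j = (\<lambda>\<omega>s. polar_word l \<omega>s ! j)"
  by (simp add: polar_bit_def polar_word_def fun_eq_iff)

lemma polar_past_eq: "polar_past n (U l) j = (\<lambda>\<omega>s. take j (polar_word l \<omega>s))"
  by (simp add: polar_past_def polar_word_def fun_eq_iff)

lemma full_law_eq:
  "full_law s l h v = cond_law (d1 l) (iid n p) (\<lambda>\<omega>s. polar_word l \<omega>s ! length v)
     (\<lambda>\<omega>s. (take (length v) (polar_word l \<omega>s), view s (history l \<omega>s))) (v, view s h)"
  by (simp add: full_law_def side_law_def polar_bit_eq polar_past_eq view_def history_def o_def)

lemma free_law_eq:
  "free_law p U n d0 l v = cond_law (d0 l) (iid n p) (\<lambda>\<omega>s. polar_word l \<omega>s ! length v)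
     (\<lambda>\<omega>s. take (length v) (polar_word l \<omega>s)) v"
  by (simp add: free_law_def polar_bit_eq polar_past_eq)

lemma bhattacharyya_side_info:
  "bhattacharyya (iid n p) (polar_bit n (U l) j)
      (\<lambda>\<omega>s. (polar_past n (U l) j \<omega>s, map (side_info X Y U s l) \<omega>s)) =
    bhattacharyya (iid n p) (\<lambda>\<omega>s. polar_word l \<omega>s ! j)
      (\<lambda>\<omega>s. (take j (polar_word l \<omega>s), view s (history l \<omega>s)))"
proof -
  have "map (side_info X Y U s l) \<omega>s = map (side_info X Y U s l) \<omega>s' \<longleftrightarrow>
      view s (history l \<omega>s) = view s (history l \<omega>s')"
    if "\<omega>s \<in> set_pmf (iid n p)" "\<omega>s' \<in> set_pmf (iid n p)" for \<omega>s \<omega>s'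
    using that map_info_transpose_eq_iff[of \<omega>s \<omega>s' "\<lambda>\<omega>. observed s (X \<omega>, Y \<omega>)" U "[1..<l]"]
    by (simp add: length_iid side_info_def[abs_def] view_def history_def o_def)
  then show ?thesis
    unfolding polar_bit_eq polar_past_eq by (intro bhattacharyya_cong_info) auto
qed

text \<open>Letter by letter, the new bit comes from the transmitter's view alone, so the block is
  the output of a memoryless channel fed with that view. This shows that some kernel of the view
  works for the full history; the chain rule given the view identifies it as the protocol's.\<close>

lemma history_polar_word_law:
  assumes "markov_kernel l" and "m \<le> 2 ^ n"
  shows "map_pmf (\<lambda>\<omega>s. (history l \<omega>s, take m (polar_word l \<omega>s))) (iid n p) =
    bind_pmf (map_pmf (history l) (iid n p))
      (\<lambda>h. map_pmf (Pair h) (sample_bits (full_law (transmitter l) l h) m))"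
proof -
  let ?s = "transmitter l" and ?P = "iid n p"
  let ?D = "\<lambda>\<omega>. ((X \<omega>, Y \<omega>), map (\<lambda>i. U i \<omega>) [1..<l])"
  let ?g = "\<lambda>d. (observed ?s (fst d), snd d)"
  from assms(1) obtain k where k: "map_pmf (\<lambda>\<omega>. (?D \<omega>, U l \<omega>)) p =
      bind_pmf (map_pmf ?D p) (\<lambda>d. map_pmf (Pair d) (k (?g d)))"
    unfolding markov_kernel_def by blast
  \<comment> \<open>Rounds are counted from 1 and list positions from 0, hence
    \<open>i - 1\<close>.\<close>
  define unzip where "unzip ds = (map fst ds, map (\<lambda>i. map (\<lambda>d. snd d ! (i - 1)) ds) [1..<l])"
    for ds :: "(('x \<times> 'y) \<times> bit list) list"
  \<comment> \<open>The inverse regrouping, which needs the block length \<open>2 ^ n\<close>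
    because it transposes blocks into letters.\<close>
  define rezip where "rezip c = map (\<lambda>j. (fst c ! j, map (\<lambda>u. u ! j) (snd c))) [0..<2 ^ n]"
    for c :: "('x + 'y) list \<times> bit list list"
  define L where "L c = map_pmf (\<lambda>as. take m (polarize n as)) (map_kernel k (rezip c))" for c
  have unzip: "unzip (map ?D \<omega>s) = history l \<omega>s" for \<omega>s
  proof -
    have "map (\<lambda>i. U i \<omega>) [1..<l] ! (i - 1) = U i \<omega>" if "i \<in> set [1..<l]" for i \<omega>
      using that by (subst nth_map) auto
    then show ?thesis
      by (simp add: unzip_def history_def o_def)
  qed
  have rezip: "rezip (view ?s (history l \<omega>s)) = map (\<lambda>\<omega>. ?g (?D \<omega>)) \<omega>s" if "\<omega>s \<in> set_pmf ?P" for \<omega>s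
    using length_iid[OF that]
    by (intro nth_equalityI) (auto simp: rezip_def view_def history_def o_def)
  have "map_pmf (\<lambda>\<omega>s. (history l \<omega>s, take m (polar_word l \<omega>s))) ?P =
      map_pmf (\<lambda>(ds, as). (unzip ds, take m (polarize n as)))
        (map_pmf (\<lambda>\<omega>s. (map ?D \<omega>s, map (U l) \<omega>s)) ?P)"
    by (simp only: pmf.map_comp o_def prod.case unzip polar_word_def)
  also have "\<dots> = bind_pmf ?P (\<lambda>\<omega>s. map_pmf (Pair (unzip (map ?D \<omega>s)))
      (map_pmf (\<lambda>as. take m (polarize n as)) (map_kernel k (map ?g (map ?D \<omega>s)))))"
    unfolding iid_def replicate_pmf_map_kernel[OF k] map_bind_Pair
    unfolding bind_map_pmf map_kernel_map[of k ?g] ..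
  also have "\<dots> = bind_pmf ?P (\<lambda>\<omega>s. map_pmf (Pair (history l \<omega>s)) (L (view ?s (history l \<omega>s))))"
    unfolding unzip L_def by (intro bind_pmf_cong refl) (simp add: rezip o_def)
  finally have EV: "map_pmf (\<lambda>\<omega>s. (history l \<omega>s, take m (polar_word l \<omega>s))) ?P =
      bind_pmf (map_pmf (history l) ?P) (\<lambda>h. map_pmf (Pair h) (L (view ?s h)))"
    by (simp add: bind_map_pmf)
  have "map_pmf (\<lambda>\<omega>s. (view ?s (history l \<omega>s), take m (polar_word l \<omega>s))) ?P =
    bind_pmf (map_pmf (\<lambda>\<omega>s. view ?s (history l \<omega>s)) ?P) (\<lambda>c. map_pmf (Pair c)
      (sample_bits (\<lambda>v. cond_law (d1 l) ?P (\<lambda>\<omega>s. polar_word l \<omega>s ! length v)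
        (\<lambda>\<omega>s. (take (length v) (polar_word l \<omega>s), view ?s (history l \<omega>s))) (v, c)) m))"
    by (rule chain_rule_sample_bits[OF _ assms(2)]) simp
  from kernel_of_part[OF EV this] show ?thesis
    by (simp only: full_law_eq[abs_def])
qed

text \<open>The sender's kernel once the shared bits are absorbed: a fresh uniform bit stands for
  \<open>r j\<close>.\<close>

definition sender_law :: "nat \<Rightarrow> ('x \<times> 'y) list \<times> bit list list \<Rightarrow> bit list \<Rightarrow> bit pmf" where
  "sender_law l h v =
     (if length v \<in> set_Fr p X Y U \<beta> n l then pmf_of_set {0, 1}
      else if length v \<in> set_Fd p U \<beta> n l then free_law p U n d0 l v
      else full_law (transmitter l) l h v)"

text \<open>Transmitted and shared positions merge: after absorption a shared bit is the sender's
  bit at that position, so both are copied from \<open>vS\<close>.\<close>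

definition receiver_law ::
  "nat \<Rightarrow> ('x \<times> 'y) list \<times> bit list list \<Rightarrow> bit list \<Rightarrow> bit list \<Rightarrow> bit pmf" where
  "receiver_law l h vS v =
     (if length v \<in> set_I' p X Y U \<beta> n l \<union> set_Fr p X Y U \<beta> n l then return_pmf (vS ! length v)
      else if length v \<in> set_Fd p U \<beta> n l then free_law p U n d0 l v
      else full_law (receiver l) l h v)"

section \<open>Errors at a single position and over a whole word\<close>

lemma free_law_error:
  assumes "j \<in> set_Fd p U \<beta> n l"
  shows "measure_pmf.expectation (iid n p)
    (\<lambda>\<omega>s. 1 - pmf (free_law p U n d0 l (take j (polar_word l \<omega>s))) (polar_word l \<omega>s ! j))
      \<le> polar_delta \<beta> n / 2"
proof -
  have j: "j < 2 ^ n" and "bhattacharyya (iid n p) (\<lambda>\<omega>s. polar_word l \<omega>s ! j)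
      (\<lambda>\<omega>s. take j (polar_word l \<omega>s)) \<le> polar_delta \<beta> n"
    using assms by (auto simp: set_Fd_def low_set_def polar_bit_eq polar_past_eq)
  from low_bhattacharyya_error[OF this(2), of "d0 l"] j show ?thesis
    by (simp add: free_law_eq min_def)
qed

lemma full_law_error:
  assumes "j \<in> low_set_cond p \<beta> n (U l) (side_info X Y U s l)"
  shows "measure_pmf.expectation (iid n p)
    (\<lambda>\<omega>s. 1 - pmf (full_law s l (history l \<omega>s) (take j (polar_word l \<omega>s))) (polar_word l \<omega>s ! j))
      \<le> polar_delta \<beta> n / 2"
proof -
  have j: "j < 2 ^ n" and "bhattacharyya (iid n p) (\<lambda>\<omega>s. polar_word l \<omega>s ! j)
      (\<lambda>\<omega>s. (take j (polar_word l \<omega>s), view s (history l \<omega>s))) \<le> polar_delta \<beta> n"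
    using assms by (auto simp: low_set_cond_def bhattacharyya_side_info)
  from low_bhattacharyya_error[OF this(2), of "d1 l"] j show ?thesis
    by (simp add: full_law_eq min_def)
qed

lemma full_law_uniform:
  assumes "j \<in> high_set_cond p \<beta> n (U l) (side_info X Y U s l)"
  shows "measure_pmf.expectation (iid n p)
    (\<lambda>\<omega>s. \<bar>pmf (full_law s l (history l \<omega>s) (take j (polar_word l \<omega>s))) 1 - 1 / 2\<bar>)
      \<le> sqrt (polar_delta \<beta> n / 2)"
proof -
  have j: "j < 2 ^ n" and "1 - polar_delta \<beta> n \<le> bhattacharyya (iid n p) (\<lambda>\<omega>s. polar_word l \<omega>s ! j)
      (\<lambda>\<omega>s. (take j (polar_word l \<omega>s), view s (history l \<omega>s)))"
    using assms by (auto simp: high_set_cond_def bhattacharyya_side_info)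
  from high_bhattacharyya_uniform[OF this(2), of "d1 l"] j show ?thesis
    by (simp add: full_law_eq min_def)
qed

lemma polar_delta_bounds: "0 < polar_delta \<beta> n" "polar_delta \<beta> n \<le> 1"
  using powr_mono[of "- (real (2 ^ n) powr \<beta>)" 0 2] by (simp_all add: polar_delta_def)

lemma polar_delta_le_sqrt:
  "polar_delta \<beta> n / 2 \<le> sqrt (polar_delta \<beta> n)"
  "sqrt (polar_delta \<beta> n / 2) \<le> sqrt (polar_delta \<beta> n)"
proof -
  have "(polar_delta \<beta> n)\<^sup>2 \<le> polar_delta \<beta> n"
    using polar_delta_bounds by (simp add: power2_eq_square mult_left_le)
  then have "polar_delta \<beta> n \<le> sqrt (polar_delta \<beta> n)"
    by (rule real_le_rsqrt)
  then show "polar_delta \<beta> n / 2 \<le> sqrt (polar_delta \<beta> n)"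
    using polar_delta_bounds by simp
  show "sqrt (polar_delta \<beta> n / 2) \<le> sqrt (polar_delta \<beta> n)"
    using polar_delta_bounds by simp
qed

lemma sender_law_step:
  assumes "markov_kernel l" and j: "j < 2 ^ n"
  defines "J \<equiv> \<lambda>m. map_pmf (\<lambda>\<omega>s. (history l \<omega>s, take m (polar_word l \<omega>s))) (iid n p)"
  shows "tv_within (sqrt (polar_delta \<beta> n))
    (bind_pmf (J j) (\<lambda>(h, v). map_pmf (\<lambda>b. (h, v @ [b])) (sender_law l h v))) (J (Suc j))"
proof -
  let ?s = "transmitter l" and ?P = "iid n p" and ?\<delta> = "polar_delta \<beta> n"
  \<comment> \<open>The ideal next bit comes from \<open>full_law\<close>, so a comparison of
    kernels, averaged over the ideal history and prefix, bounds the step.\<close>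
  have step: "tv_within (measure_pmf.expectation ?P (\<lambda>\<omega>s. e (history l \<omega>s) (take j (polar_word l \<omega>s))))
      (bind_pmf (J j) (\<lambda>(h, v). map_pmf (\<lambda>b. (h, v @ [b])) (sender_law l h v))) (J (Suc j))"
    if e: "\<And>h v. length v = j \<Longrightarrow> tv_within (e h v) (sender_law l h v) (full_law ?s l h v)"
      and b: "\<And>h v. \<bar>e h v\<bar> \<le> 1" for e
  proof -
    have "J (Suc j) = bind_pmf (J j) (\<lambda>(h, v). map_pmf (\<lambda>b. (h, v @ [b])) (full_law ?s l h v))"
      using j unfolding J_def
      by (simp add: history_polar_word_law[OF assms(1)] sample_bits_Suc map_bind_pmf bind_assoc_pmf
          bind_map_pmf pmf.map_comp o_def del: sample_bits.simps)
    moreover have "tv_within (measure_pmf.expectation (J j) (\<lambda>(h, v). e h v))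
        (bind_pmf (J j) (\<lambda>(h, v). map_pmf (\<lambda>b. (h, v @ [b])) (sender_law l h v)))
        (bind_pmf (J j) (\<lambda>(h, v). map_pmf (\<lambda>b. (h, v @ [b])) (full_law ?s l h v)))"
      by (rule tv_within_bind_right[where B = 1])
        (use j b in \<open>auto simp: J_def min_def intro!: tv_within_map e split: if_splits\<close>)
    ultimately show ?thesis
      by (simp add: J_def)
  qed
  consider "j \<in> set_Fr p X Y U \<beta> n l" | "j \<notin> set_Fr p X Y U \<beta> n l" "j \<in> set_Fd p U \<beta> n l"
    | "j \<notin> set_Fr p X Y U \<beta> n l" "j \<notin> set_Fd p U \<beta> n l"
    by blast
  then show ?thesis
  proof cases
    case 1
    define e where "e h v = \<bar>pmf (full_law ?s l h v) 1 - 1 / 2\<bar>" for h v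
    have b: "\<bar>e h v\<bar> \<le> 1" for h v
      using pmf_nonneg[of "full_law ?s l h v" 1] pmf_le_1[of "full_law ?s l h v" 1]
      unfolding e_def by linarith
    have "pmf (pmf_of_set {0, 1 :: bit}) 1 = 1 / 2"
      by (subst pmf_of_set) auto
    then have "tv_within (e h v) (sender_law l h v) (full_law ?s l h v)" if "length v = j" for h v
      using 1 that tv_within_bit[of "sender_law l h v" "full_law ?s l h v"]
      by (simp add: e_def sender_law_def abs_minus_commute)
    from step[where e = e, OF this b] show ?thesis
      by (rule tv_within_mono) (use 1 in \<open>auto simp: set_Fr_def e_def
        intro!: order_trans[OF full_law_uniform polar_delta_le_sqrt(2)]\<close>)
  next
    case 2
    \<comment> \<open>The two conditional laws are not compared directly: by the independent
      coupling it is enough that a sample from \<open>free_law\<close> usually matches one from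
      \<open>full_law\<close>.\<close>
    define e where "e h v = measure_pmf.expectation (full_law ?s l h v)
      (\<lambda>b. 1 - pmf (free_law p U n d0 l v) b)" for h v
    have b: "\<bar>e h v\<bar> \<le> 1" for h v
      using expectation_pmf_bounds[of "\<lambda>b. 1 - pmf (free_law p U n d0 l v) b" "full_law ?s l h v"]
      by (simp add: e_def pmf_le_1)
    have "tv_within (e h v) (sender_law l h v) (full_law ?s l h v)" if "length v = j" for h v
      using 2 that tv_within_expected_error by (simp add: e_def sender_law_def)
    note * = step[where e = e, OF this b]
    \<comment> \<open>By the tower property a sample from \<open>full_law\<close> may be replaced by
      the ideal bit itself; \<open>e\<close> sees the history only through the transmitter's
      view.\<close>
    have "measure_pmf.expectation ?P (\<lambda>\<omega>s. e (history l \<omega>s) (take j (polar_word l \<omega>s))) =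
        measure_pmf.expectation ?P
          (\<lambda>\<omega>s. 1 - pmf (free_law p U n d0 l (take j (polar_word l \<omega>s))) (polar_word l \<omega>s ! j))"
      using expectation_cond_law[of "\<lambda>(v, c) b. 1 - pmf (free_law p U n d0 l v) b" 1 ?P
          "\<lambda>\<omega>s. (take j (polar_word l \<omega>s), view ?s (history l \<omega>s))"
          "\<lambda>\<omega>s. polar_word l \<omega>s ! j" "d1 l"] j
      by (simp add: e_def full_law_eq min_def pmf_le_1 split_beta)
    with * free_law_error[OF 2(2)] polar_delta_le_sqrt show ?thesis
      by (auto intro: tv_within_mono)
  next
    case 3
    \<comment> \<open>The remaining positions are those of \<open>set_I\<close>, where the two
      kernels coincide.\<close>
    have "tv_within 0 (sender_law l h v) (full_law ?s l h v)" if "length v = j" for h v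
      using 3 that by (simp add: sender_law_def tv_within_refl)
    from step[where e = "\<lambda>_ _. 0", OF this] show ?thesis
      by (rule tv_within_mono) (use polar_delta_bounds in auto)
  qed
qed

lemma sender_law_close:
  assumes "markov_kernel l"
  shows "tv_within (2 ^ n * sqrt (polar_delta \<beta> n))
    (bind_pmf (map_pmf (history l) (iid n p))
      (\<lambda>h. map_pmf (Pair h) (sample_bits (sender_law l h) (2 ^ n))))
    (map_pmf (\<lambda>\<omega>s. (history l \<omega>s, polar_word l \<omega>s)) (iid n p))"
proof -
  have "tv_within (\<Sum>j<(2 ^ n :: nat). sqrt (polar_delta \<beta> n))
    (bind_pmf (map_pmf (history l) (iid n p))
      (\<lambda>h. map_pmf (Pair h) (sample_bits (sender_law l h) (2 ^ n))))
    (bind_pmf (map_pmf (history l) (iid n p))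
      (\<lambda>h. map_pmf (Pair h) (sample_bits (full_law (transmitter l) l h) (2 ^ n))))"
  proof (rule tv_within_sample_bits_averaged)
    fix j :: nat
    assume "j < 2 ^ n"
    with sender_law_step[OF assms this] show "tv_within (sqrt (polar_delta \<beta> n))
      (bind_pmf (bind_pmf (map_pmf (history l) (iid n p))
          (\<lambda>h. map_pmf (Pair h) (sample_bits (full_law (transmitter l) l h) j)))
        (\<lambda>(h, v). map_pmf (\<lambda>b. (h, v @ [b])) (sender_law l h v)))
      (bind_pmf (map_pmf (history l) (iid n p))
        (\<lambda>h. map_pmf (Pair h) (sample_bits (full_law (transmitter l) l h) (Suc j))))"
      by (simp add: history_polar_word_law[OF assms] del: sample_bits.simps)
  qed
  then show ?thesis
    by (simp flip: history_polar_word_law[OF assms])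
qed

lemma receiver_law_error:
  assumes "j < 2 ^ n"
  shows "measure_pmf.expectation (iid n p) (\<lambda>\<omega>s. 1 - pmf (receiver_law l (history l \<omega>s)
    (polar_word l \<omega>s) (take j (polar_word l \<omega>s))) (polar_word l \<omega>s ! j)) \<le> sqrt (polar_delta \<beta> n)"
proof -
  consider "j \<in> set_I' p X Y U \<beta> n l \<union> set_Fr p X Y U \<beta> n l"
    | "j \<notin> set_I' p X Y U \<beta> n l \<union> set_Fr p X Y U \<beta> n l" "j \<in> set_Fd p U \<beta> n l"
    | "j \<notin> set_I' p X Y U \<beta> n l \<union> set_Fr p X Y U \<beta> n l" "j \<notin> set_Fd p U \<beta> n l"
    by blast
  then show ?thesis
  proof cases
    case 1
    with assms polar_delta_bounds show ?thesis
      by (simp add: receiver_law_def min_def)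
  next
    case 2
    with assms free_law_error[OF 2(2)] polar_delta_le_sqrt show ?thesis
      by (simp add: receiver_law_def min_def)
  next
    case 3
    \<comment> \<open>Outside \<open>set_Fr\<close> and \<open>set_Fd\<close> the position lies in
      \<open>set_I\<close>; not being transmitted, it is among those removed to form
      \<open>set_I'\<close>.\<close>
    then have "j \<in> low_set_cond p \<beta> n (U l) (side_info X Y U (receiver l) l)"
      using assms by (auto simp: set_I'_def set_I_def set_Fr_def set_Fd_def)
    with 3 assms full_law_error polar_delta_le_sqrt show ?thesis
      by (fastforce simp: receiver_law_def min_def intro: order_trans)
  qed
qed

text \<open>For each outcome the receiver's word is compared with the point mass at the ideal word,
  and the errors are then averaged. What enters is the joint law of the word with the receiver's own
  view.\<close>

lemma receiver_law_close:
  "tv_within (2 ^ n * sqrt (polar_delta \<beta> n))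
    (bind_pmf (map_pmf (\<lambda>\<omega>s. (history l \<omega>s, polar_word l \<omega>s)) (iid n p))
      (\<lambda>(h, v). map_pmf (\<lambda>w. (h, v, w)) (sample_bits (receiver_law l h v) (2 ^ n))))
    (map_pmf (\<lambda>\<omega>s. (history l \<omega>s, polar_word l \<omega>s, polar_word l \<omega>s)) (iid n p))"
proof -
  let ?P = "iid n p" and ?N = "2 ^ n :: nat"
  let ?err = "\<lambda>j \<omega>s. 1 - pmf (receiver_law l (history l \<omega>s)
    (polar_word l \<omega>s) (take j (polar_word l \<omega>s))) (polar_word l \<omega>s ! j)"
  have err: "0 \<le> ?err j \<omega>s" "?err j \<omega>s \<le> 1" for j \<omega>s
    by (simp_all add: pmf_le_1)
  have "tv_within (\<Sum>j<?N. ?err j \<omega>s)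
      (map_pmf (\<lambda>w. (history l \<omega>s, polar_word l \<omega>s, w))
        (sample_bits (receiver_law l (history l \<omega>s) (polar_word l \<omega>s)) ?N))
      (return_pmf (history l \<omega>s, polar_word l \<omega>s, polar_word l \<omega>s))" for \<omega>s
    using tv_within_map[OF tv_within_sample_bits_return[of ?N "polar_word l \<omega>s"],
        of "receiver_law l (history l \<omega>s) (polar_word l \<omega>s)" "\<lambda>w. (history l \<omega>s, polar_word l \<omega>s, w)"]
    by simp
  \<comment> \<open>A crude bound, wanted only for integrability; the useful one is on the
    expectation.\<close>
  moreover have "\<bar>\<Sum>j<?N. ?err j \<omega>s\<bar> \<le> 2 ^ n" for \<omega>s
  proof -
    have "\<bar>\<Sum>j<?N. ?err j \<omega>s\<bar> \<le> (\<Sum>j<?N. \<bar>?err j \<omega>s\<bar>)"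
      by (rule sum_abs)
    also have "\<dots> \<le> (\<Sum>j<?N. 1)"
      by (intro sum_mono) (use err in auto)
    finally show ?thesis by simp
  qed
  ultimately have "tv_within (measure_pmf.expectation ?P (\<lambda>\<omega>s. \<Sum>j<?N. ?err j \<omega>s))
    (bind_pmf ?P (\<lambda>\<omega>s. map_pmf (\<lambda>w. (history l \<omega>s, polar_word l \<omega>s, w))
        (sample_bits (receiver_law l (history l \<omega>s) (polar_word l \<omega>s)) ?N)))
    (bind_pmf ?P (\<lambda>\<omega>s. return_pmf (history l \<omega>s, polar_word l \<omega>s, polar_word l \<omega>s)))"
    by (rule tv_within_bind_right)
  moreover have "measure_pmf.expectation ?P (\<lambda>\<omega>s. \<Sum>j<?N. ?err j \<omega>s) \<le> 2 ^ n * sqrt (polar_delta \<beta> n)"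
  proof -
    have "measure_pmf.expectation ?P (\<lambda>\<omega>s. \<Sum>j<?N. ?err j \<omega>s) =
        (\<Sum>j<?N. measure_pmf.expectation ?P (?err j))"
      by (rule Bochner_Integration.integral_sum) (rule integrable_pmf_bounded[of _ 1], use err in auto)
    also have "\<dots> \<le> (\<Sum>j<?N. sqrt (polar_delta \<beta> n))"
      by (intro sum_mono receiver_law_error) simp
    finally show ?thesis by simp
  qed
  ultimately show ?thesis
    by (auto simp: bind_map_pmf map_pmf_def[of "\<lambda>\<omega>s. (history l \<omega>s, polar_word l \<omega>s, polar_word l \<omega>s)"]
        intro: tv_within_mono)
qed

abbreviation round_result :: "nat \<Rightarrow> bit list list \<Rightarrow> bit list \<Rightarrow> bit list \<Rightarrow> terminal \<Rightarrow> bit list list" where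
  "round_result l us v w \<equiv>
     (\<lambda>_. us)(transmitter l := us @ [polarize n v], receiver l := us @ [polarize n w])"

lemma protocol_round_agreed:
  "protocol_round p X Y U \<beta> n d0 d1 (\<lambda>s. map (observed s) xy) l (\<lambda>_. us) =
    bind_pmf (sample_bits (sender_law l (xy, us)) (2 ^ n)) (\<lambda>v.
      map_pmf (round_result l us v) (sample_bits (receiver_law l (xy, us) v) (2 ^ n)))"
proof -
  let ?F = "set_Fr p X Y U \<beta> n l" and ?S = "transmitter l" and ?R = "receiver l"
  let ?K = "\<lambda>v. if length v \<in> set_Fd p U \<beta> n l then free_law p U n d0 l v
    else side_law p X Y U n d1 ?S l (map (observed ?S) xy) us v"
  let ?G = "\<lambda>r v. if length v \<in> ?F then return_pmf (r (length v)) else ?K v"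
  let ?next = "\<lambda>(r :: nat \<Rightarrow> bit, vS). bind_pmf (sample_bits
      (\<lambda>v. if length v \<in> set_I' p X Y U \<beta> n l then return_pmf (vS ! length v)
        else if length v \<in> ?F then return_pmf (r (length v))
        else if length v \<in> set_Fd p U \<beta> n l then free_law p U n d0 l v
        else side_law p X Y U n d1 ?R l (map (observed ?R) xy) us v) (2 ^ n))
      (\<lambda>vR. return_pmf (round_result l us vS vR))"
  have F: "?F \<inter> {..<2 ^ n} = ?F"
    by (auto simp: set_Fr_def)
  have "protocol_round p X Y U \<beta> n d0 d1 (\<lambda>s. map (observed s) xy) l (\<lambda>_. us) =
      bind_pmf (bind_pmf (Pi_pmf ?F 0 (\<lambda>_. pmf_of_set {0, 1}))
        (\<lambda>r. map_pmf (Pair r) (sample_bits (?G r) (2 ^ n)))) ?next"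
    by (simp add: protocol_round_def Let_def bind_assoc_pmf bind_map_pmf)
  also have "\<dots> = bind_pmf (sample_bits (\<lambda>v. if length v \<in> ?F then pmf_of_set {0, 1} else ?K v) (2 ^ n))
      (\<lambda>v. ?next (\<lambda>j. if j \<in> ?F then v ! j else 0, v))"
    using shared_bits_sample_bits[of ?F "2 ^ n" "pmf_of_set {0, 1}" ?K]
    unfolding F by (simp add: bind_map_pmf)
  also have "(\<lambda>v. if length v \<in> ?F then pmf_of_set {0, 1} else ?K v) = sender_law l (xy, us)"
    by (auto simp: sender_law_def full_law_def view_def fun_eq_iff)
  \<comment> \<open>On \<open>set_Fr\<close> the recovered family returns the sender's bit, which
    merges the receiver's first two branches.\<close>
  also have "(\<lambda>v. ?next (\<lambda>j. if j \<in> ?F then v ! j else 0, v)) =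
      (\<lambda>v. map_pmf (round_result l us v) (sample_bits (receiver_law l (xy, us) v) (2 ^ n)))"
    unfolding map_pmf_def prod.case
    by (intro ext bind_pmf_cong sample_bits_cong refl)
      (auto simp: receiver_law_def full_law_def view_def)
  finally show ?thesis .
qed

definition joint_rounds :: "nat \<Rightarrow> (('x \<times> 'y) list \<times> (terminal \<Rightarrow> bit list list)) pmf" where
  "joint_rounds l = bind_pmf (iid n (map_pmf (\<lambda>\<omega>. (X \<omega>, Y \<omega>)) p))
     (\<lambda>xy. map_pmf (Pair xy) (protocol_rounds p X Y U \<beta> n d0 d1 (\<lambda>s. map (observed s) xy) l))"

text \<open>\<open>history\<close> collects the rounds strictly before its index, so the state after
  \<open>l\<close> rounds is read at \<open>Suc l\<close>.\<close>

definition agreed_rounds :: "nat \<Rightarrow> (('x \<times> 'y) list \<times> (terminal \<Rightarrow> bit list list)) pmf" where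
  "agreed_rounds l = map_pmf (\<lambda>\<omega>s. (fst (history (Suc l) \<omega>s), \<lambda>_. snd (history (Suc l) \<omega>s))) (iid n p)"

lemma agreed_round_close:
  assumes "markov_kernel (Suc l)"
  shows "tv_within (2 * (2 ^ n * sqrt (polar_delta \<beta> n)))
    (bind_pmf (agreed_rounds l) (\<lambda>(xy, u). map_pmf (Pair xy)
      (protocol_round p X Y U \<beta> n d0 d1 (\<lambda>s. map (observed s) xy) (Suc l) u)))
    (agreed_rounds (Suc l))"
proof -
  let ?l = "Suc l" and ?P = "iid n p"
  let ?out = "\<lambda>(h, v, w). (fst h :: ('x \<times> 'y) list, round_result ?l (snd h) v w)"
  let ?rcv = "\<lambda>(h, v). map_pmf (\<lambda>w. (h, v, w)) (sample_bits (receiver_law ?l h v) (2 ^ n))"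
  have "bind_pmf (agreed_rounds l) (\<lambda>(xy, u). map_pmf (Pair xy)
      (protocol_round p X Y U \<beta> n d0 d1 (\<lambda>s. map (observed s) xy) ?l u)) =
    map_pmf ?out (bind_pmf (bind_pmf (map_pmf (history ?l) ?P)
      (\<lambda>h. map_pmf (Pair h) (sample_bits (sender_law ?l h) (2 ^ n)))) ?rcv)"
    by (simp add: agreed_rounds_def bind_map_pmf protocol_round_agreed map_bind_pmf bind_assoc_pmf
        pmf.map_comp o_def)
  moreover have "agreed_rounds ?l =
      map_pmf ?out (map_pmf (\<lambda>\<omega>s. (history ?l \<omega>s, polar_word ?l \<omega>s, polar_word ?l \<omega>s)) ?P)"
    unfolding agreed_rounds_def pmf.map_comp
  proof (rule map_pmf_cong[OF refl])
    fix \<omega>s assume "\<omega>s \<in> set_pmf ?P"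
    then have "polarize n (polar_word ?l \<omega>s) = map (U ?l) \<omega>s"
      by (simp add: polar_word_def polarize_involution length_iid)
    \<comment> \<open>Both entries of the state are overwritten, so the result is again a constant
      function.\<close>
    moreover have "s = transmitter ?l \<or> s = receiver ?l" for s
      by (cases s) (auto simp: transmitter_def receiver_def)
    ultimately show "(fst (history (Suc ?l) \<omega>s), \<lambda>_. snd (history (Suc ?l) \<omega>s)) =
      (?out \<circ> (\<lambda>\<omega>s. (history ?l \<omega>s, polar_word ?l \<omega>s, polar_word ?l \<omega>s))) \<omega>s"
      by (auto simp: history_def fun_eq_iff)
  qed
  moreover note tv_within_map[OF tv_within_trans[OF
    tv_within_bind_left[OF sender_law_close[OF assms]] receiver_law_close], of ?out]
  ultimately show ?thesis
    by (simp only: mult_2)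
qed

text \<open>Earlier errors pass through the actual round by data processing; the new error, one
  share for each word, is then charged from an ideal start.\<close>

lemma joint_rounds_close:
  assumes "\<And>k. k \<in> {1..l} \<Longrightarrow> markov_kernel k"
  shows "tv_within (real l * (2 * (2 ^ n * sqrt (polar_delta \<beta> n)))) (joint_rounds l) (agreed_rounds l)"
  using assms
proof (induction l)
  case 0
  have "joint_rounds 0 = agreed_rounds 0"
    by (simp add: joint_rounds_def agreed_rounds_def iid_def history_def bind_map_pmf
        flip: map_replicate_pmf) (simp add: map_pmf_def)
  then show ?case
    by (simp add: tv_within_refl)
next
  case (Suc l)
  let ?step = "\<lambda>(xy, u). map_pmf (Pair xy)
      (protocol_round p X Y U \<beta> n d0 d1 (\<lambda>s. map (observed s) xy) (Suc l) u)"
  have "joint_rounds (Suc l) = bind_pmf (joint_rounds l) ?step"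
    by (simp add: joint_rounds_def map_bind_pmf bind_assoc_pmf bind_map_pmf)
  moreover have "tv_within (real l * (2 * (2 ^ n * sqrt (polar_delta \<beta> n)))
      + 2 * (2 ^ n * sqrt (polar_delta \<beta> n))) (bind_pmf (joint_rounds l) ?step) (agreed_rounds (Suc l))"
    using Suc.prems
    by (intro tv_within_trans[OF tv_within_bind_left[OF Suc.IH] agreed_round_close]) auto
  ultimately show ?case
    by (simp add: algebra_simps)
qed

lemma protocol_law_joint_rounds:
  "protocol_law p X Y U \<beta> n d0 d1 t =
    map_pmf (\<lambda>(xy, u). (u Terminal_A, u Terminal_B, map fst xy, map snd xy)) (joint_rounds t)"
  by (simp add: protocol_law_def joint_rounds_def map_pmf_def bind_assoc_pmf bind_return_pmf)

lemma ideal_law_agreed_rounds: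
  "map_pmf (\<lambda>(xy, u). (u s, map fst xy, map snd xy)) (agreed_rounds t) = ideal_law p X Y U n t"
  by (simp add: ideal_law_def agreed_rounds_def history_def pmf.map_comp o_def)

lemma protocol_law_bounds:
  assumes "\<And>k. k \<in> {1..t} \<Longrightarrow> markov_kernel k"
  defines "e \<equiv> real t * (2 * (2 ^ n * sqrt (polar_delta \<beta> n)))"
  shows "1 - measure_pmf.prob (protocol_law p X Y U \<beta> n d0 d1 t) {(uA, uB, xs, ys). uA = uB} \<le> e"
    and "l1_dist (map_pmf (\<lambda>(uA, uB, xs, ys). (uA, xs, ys)) (protocol_law p X Y U \<beta> n d0 d1 t))
      (ideal_law p X Y U n t) \<le> 2 * e"
    and "l1_dist (map_pmf (\<lambda>(uA, uB, xs, ys). (uB, xs, ys)) (protocol_law p X Y U \<beta> n d0 d1 t))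
      (ideal_law p X Y U n t) \<le> 2 * e"
proof -
  have close: "tv_within e (joint_rounds t) (agreed_rounds t)"
    unfolding e_def by (rule joint_rounds_close[OF assms(1)])
  have "1 - measure_pmf.prob (protocol_law p X Y U \<beta> n d0 d1 t) {(uA, uB, xs, ys). uA = uB} =
      measure_pmf.prob (joint_rounds t) {(xy, u). u Terminal_A \<noteq> u Terminal_B}"
    unfolding protocol_law_joint_rounds measure_map_pmf
    by (subst measure_pmf.prob_compl[symmetric])
      (auto intro!: arg_cong[where f = "measure_pmf.prob (joint_rounds t)"])
  also have "\<dots> \<le> measure_pmf.prob (agreed_rounds t) {(xy, u). u Terminal_A \<noteq> u Terminal_B} + e"
    by (rule tv_within_prob[OF close])
  also have "measure_pmf.prob (agreed_rounds t) {(xy, u). u Terminal_A \<noteq> u Terminal_B} = 0"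
    by (simp add: agreed_rounds_def vimage_def)
  finally show "1 - measure_pmf.prob (protocol_law p X Y U \<beta> n d0 d1 t) {(uA, uB, xs, ys). uA = uB} \<le> e"
    by (simp only: add_0_left)
  show "l1_dist (map_pmf (\<lambda>(uA, uB, xs, ys). (uA, xs, ys)) (protocol_law p X Y U \<beta> n d0 d1 t))
      (ideal_law p X Y U n t) \<le> 2 * e"
    using l1_dist_le[OF tv_within_map[OF close, of "\<lambda>(xy, u). (u Terminal_A, map fst xy, map snd xy)"]]
    unfolding ideal_law_agreed_rounds
    by (simp add: protocol_law_joint_rounds pmf.map_comp o_def case_prod_unfold)
  show "l1_dist (map_pmf (\<lambda>(uA, uB, xs, ys). (uB, xs, ys)) (protocol_law p X Y U \<beta> n d0 d1 t))
      (ideal_law p X Y U n t) \<le> 2 * e"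
    using l1_dist_le[OF tv_within_map[OF close, of "\<lambda>(xy, u). (u Terminal_B, map fst xy, map snd xy)"]]
    unfolding ideal_law_agreed_rounds
    by (simp add: protocol_law_joint_rounds pmf.map_comp o_def case_prod_unfold)
qed

lemma markov_kernel_odd:
  assumes "odd l" "markov_chain p (U l) (\<lambda>\<omega>. (X \<omega>, map (\<lambda>k. U k \<omega>) [1..<l])) Y"
  shows "markov_kernel l"
proof -
  let ?us = "\<lambda>\<omega>. map (\<lambda>k. U k \<omega>) [1..<l]"
  let ?K = "cond_law (\<lambda>_. return_pmf 0) p (U l) (\<lambda>\<omega>. (X \<omega>, ?us \<omega>))"
  have "map_pmf (\<lambda>\<omega>. (((X \<omega>, Y \<omega>), ?us \<omega>), U l \<omega>)) p =
      map_pmf (\<lambda>(((x, us), y), a). (((x, y), us), a)) (map_pmf (\<lambda>\<omega>. (((X \<omega>, ?us \<omega>), Y \<omega>), U l \<omega>)) p)"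
    by (simp add: pmf.map_comp o_def)
  also have "\<dots> = bind_pmf p (\<lambda>\<omega>. map_pmf (Pair ((X \<omega>, Y \<omega>), ?us \<omega>)) (?K (X \<omega>, ?us \<omega>)))"
    unfolding markov_chain_kernel[OF assms(2), of "\<lambda>_. return_pmf 0"]
    by (simp add: map_bind_pmf bind_map_pmf pmf.map_comp o_def)
  \<comment> \<open>Terminal A transmits in odd rounds; \<open>projl\<close> strips the tag
    \<open>Inl\<close> from its observation.\<close>
  finally show ?thesis
    unfolding markov_kernel_def using assms(1)
    by (intro exI[of _ "\<lambda>c. ?K (projl (fst c), snd c)"]) (simp add: bind_map_pmf transmitter_def)
qed

lemma markov_kernel_even:
  assumes "even l" "markov_chain p (U l) (\<lambda>\<omega>. (Y \<omega>, map (\<lambda>k. U k \<omega>) [1..<l])) X"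
  shows "markov_kernel l"
proof -
  let ?us = "\<lambda>\<omega>. map (\<lambda>k. U k \<omega>) [1..<l]"
  let ?K = "cond_law (\<lambda>_. return_pmf 0) p (U l) (\<lambda>\<omega>. (Y \<omega>, ?us \<omega>))"
  have "map_pmf (\<lambda>\<omega>. (((X \<omega>, Y \<omega>), ?us \<omega>), U l \<omega>)) p =
      map_pmf (\<lambda>(((y, us), x), a). (((x, y), us), a)) (map_pmf (\<lambda>\<omega>. (((Y \<omega>, ?us \<omega>), X \<omega>), U l \<omega>)) p)"
    by (simp add: pmf.map_comp o_def)
  also have "\<dots> = bind_pmf p (\<lambda>\<omega>. map_pmf (Pair ((X \<omega>, Y \<omega>), ?us \<omega>)) (?K (Y \<omega>, ?us \<omega>)))"
    unfolding markov_chain_kernel[OF assms(2), of "\<lambda>_. return_pmf 0"]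
    by (simp add: map_bind_pmf bind_map_pmf pmf.map_comp o_def)
  finally show ?thesis
    unfolding markov_kernel_def using assms(1)
    by (intro exI[of _ "\<lambda>c. ?K (projr (fst c), snd c)"]) (simp add: bind_map_pmf transmitter_def)
qed

end

text \<open>With \<open>N = 2 ^ n\<close> the left side is 2 to the power
  \<open>log 2 N - N powr \<beta> / 2\<close>, and \<open>N powr \<beta>\<close> eventually
  dominates both \<open>log 2 N\<close> and \<open>N powr \<beta>\<^sub>3\<close>.\<close>

lemma block_sqrt_polar_delta_bigo:
  assumes "0 < \<beta>\<^sub>3" "\<beta>\<^sub>3 < \<beta>"
  shows "(\<lambda>n. 2 ^ n * sqrt (polar_delta \<beta> n)) \<in> O(\<lambda>n. 2 powr (- (real (2 ^ n) powr \<beta>\<^sub>3)))"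
proof -
  have "\<forall>\<^sub>F x in at_top. log 2 x + x powr \<beta>\<^sub>3 \<le> x powr \<beta> / 2"
    using assms by real_asymp
  moreover have "filterlim (\<lambda>n. real (2 ^ n)) at_top sequentially"
    by real_asymp
  ultimately have "\<forall>\<^sub>F n in sequentially. log 2 (real (2 ^ n)) + real (2 ^ n) powr \<beta>\<^sub>3 \<le> real (2 ^ n) powr \<beta> / 2"
    by (rule eventually_compose_filterlim)
  then have "\<forall>\<^sub>F n in sequentially. norm (2 ^ n * sqrt (polar_delta \<beta> n))
      \<le> 1 * norm (2 powr (- (real (2 ^ n) powr \<beta>\<^sub>3)))"
  proof eventually_elim
    case (elim n)
    let ?x = "real (2 ^ n)"
    have "?x * sqrt (polar_delta \<beta> n) = 2 powr (log 2 ?x) * 2 powr (- (?x powr \<beta>) / 2)"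
      by (simp add: polar_delta_def powr_half_sqrt[symmetric] powr_powr powr_realpow)
    also have "\<dots> = 2 powr (log 2 ?x - ?x powr \<beta> / 2)"
      by (simp flip: powr_add)
    also have "\<dots> \<le> 2 powr (- (?x powr \<beta>\<^sub>3))"
      using elim by (intro powr_mono) auto
    finally show ?case
      using polar_delta_bounds(1)[of \<beta> n] by simp
  qed
  then show ?thesis
    by (rule bigoI)
qed

theorem lemma7:
  fixes p :: "'w pmf"
    and X :: "'w \<Rightarrow> 'x :: finite" and Y :: "'w \<Rightarrow> 'y :: finite" and U :: "nat \<Rightarrow> 'w \<Rightarrow> bit"
    and t :: nat and \<beta> \<beta>\<^sub>3 :: real
    and d0 :: "nat \<Rightarrow> nat \<Rightarrow> bit list \<Rightarrow> bit pmf"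
    and d1 :: "nat \<Rightarrow> nat \<Rightarrow> bit list \<times> ('x + 'y) list \<times> bit list list \<Rightarrow> bit pmf"
  assumes "t \<ge> 1"
    and "\<And>i. i \<in> {1..t} \<Longrightarrow> odd i \<Longrightarrow>
           markov_chain p (U i) (\<lambda>\<omega>. (X \<omega>, map (\<lambda>k. U k \<omega>) [1..<i])) Y"
    and "\<And>i. i \<in> {1..t} \<Longrightarrow> even i \<Longrightarrow>
           markov_chain p (U i) (\<lambda>\<omega>. (Y \<omega>, map (\<lambda>k. U k \<omega>) [1..<i])) X"
    and "0 < \<beta>\<^sub>3" and "\<beta>\<^sub>3 < \<beta>" and "\<beta> < 1 / 2"
  shows
    "(\<lambda>n. 1 - measure_pmf.prob (protocol_law p X Y U \<beta> n (d0 n) (d1 n) t)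
                {(uA, uB, xs, ys). uA = uB})
       \<in> O(\<lambda>n. 2 powr (- (real (2 ^ n) powr \<beta>\<^sub>3))) \<and>
     (\<lambda>n. l1_dist (map_pmf (\<lambda>(uA, uB, xs, ys). (uA, xs, ys))
                    (protocol_law p X Y U \<beta> n (d0 n) (d1 n) t))
                  (ideal_law p X Y U n t))
       \<in> O(\<lambda>n. 2 powr (- (real (2 ^ n) powr \<beta>\<^sub>3))) \<and>
     (\<lambda>n. l1_dist (map_pmf (\<lambda>(uA, uB, xs, ys). (uB, xs, ys))
                    (protocol_law p X Y U \<beta> n (d0 n) (d1 n) t))
                  (ideal_law p X Y U n t))
       \<in> O(\<lambda>n. 2 powr (- (real (2 ^ n) powr \<beta>\<^sub>3)))"
proof -
  let ?g = "\<lambda>n. 2 powr (- (real (2 ^ n) powr \<beta>\<^sub>3))"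
  let ?e = "\<lambda>n. real t * (2 * (2 ^ n * sqrt (polar_delta \<beta> n)))"
  have kernel: "markov_kernel p X Y U k" if "k \<in> {1..t}" for k
    using that assms(2,3) by (cases "odd k") (auto intro: markov_kernel_odd markov_kernel_even)
  have e: "?e \<in> O(?g)"
    using block_sqrt_polar_delta_bigo[OF assms(4,5)] assms(1) by simp
  have nonneg: "0 \<le> ?e n" for n
    using polar_delta_bounds(1)[of \<beta> n] by simp
  \<comment> \<open>One pattern serves all three claims; the agreement bound is weakened from
    \<open>?e\<close> to twice that. The bounds hold for each \<open>n\<close> separately, so the
    defaults \<open>d0 n\<close> and \<open>d1 n\<close> may vary with \<open>n\<close>.\<close>
  have bigo: "f \<in> O(?g)" if "\<And>n. 0 \<le> f n" "\<And>n. f n \<le> 2 * ?e n" for f :: "nat \<Rightarrow> real"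
  proof (rule landau_o.big_trans[OF _ e])
    have "norm (f n) \<le> 2 * norm (?e n)" for n
      using that(1)[of n] that(2)[of n] nonneg[of n] by (simp only: real_norm_def abs_of_nonneg)
    then show "f \<in> O(?e)"
      by (intro bigoI[of _ 2] always_eventually allI)
  qed
  note bounds = protocol_law_bounds[where p = p and X = X and Y = Y and U = U and t = t and \<beta> = \<beta>, OF kernel]
  show ?thesis
  proof (intro conjI bigo)
    fix n
    show "1 - measure_pmf.prob (protocol_law p X Y U \<beta> n (d0 n) (d1 n) t) {(uA, uB, xs, ys). uA = uB} \<le> 2 * ?e n"
      using bounds(1)[where n = n and ?d0.0 = "d0 n" and ?d1.0 = "d1 n"] nonneg[of n] by linarith
  qed (use bounds(2,3) in \<open>auto simp: l1_dist_nonneg\<close>)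
qed

end
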